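(* Let $1<p\leq 2$. There exists a constant $C_p>0$ such that for all $N\in\mathbb{N}$ and every $f:\mathbb{Z}\to\mathbb{R}$, $$\|\mathcal A_Nf\|_{p'}\leq C_p\,N^{\frac{1}{p'}-\frac{1}{p}}\|f\|_p,$$ where $\mathcal A_{N}f(x)=\frac{1}{N}\sum_{q\leq N,\ q \text{ prime}}f(x-q)\log q$ for $x\in\mathbb{Z}$.
   Context: For $f:\mathbb{Z}\to\mathbb{R}$, $\|f\|_p$ denotes the $\ell^p(\mathbb{Z})$-norm, and $p'=\frac{p}{p-1}$ is the conjugate exponent. $\log$ is the natural logarithm. *)

theory Defs
  imports "HOL-Analysis.Analysis"
begin

definition lp_norm :: "real \<Rightarrow> (int \<Rightarrow> real) \<Rightarrow> real" where
  "lp_norm p f = (\<Sum>\<^sub>\<infinity>x\<in>(UNIV::int set). \<bar>f x\<bar> powr p) powr (1 / p)"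

definition in_lp :: "real \<Rightarrow> (int \<Rightarrow> real) \<Rightarrow> bool" where
  "in_lp p f \<longleftrightarrow> (\<lambda>x. \<bar>f x\<bar> powr p) summable_on (UNIV::int set)"

definition conj_exp :: "real \<Rightarrow> real" where
  "conj_exp p = p / (p - 1)"

definition prime_avg :: "nat \<Rightarrow> (int \<Rightarrow> real) \<Rightarrow> int \<Rightarrow> real" where
  "prime_avg N f x = (1 / real N) * (\<Sum>q\<in>{q::nat. prime q \<and> q \<le> N}. f (x - int q) * ln (real q))"

end

theory Submission
  imports Defs "HOL-Computational_Algebra.Squarefree"
begin

text \<open>The kernel is nonnegative, so it suffices to treat integer exponents \<open>p' = m\<close>: Hoelder's inequality
  alone interpolates between them. Expanding \<open>\<Sum>x. (T f x) ^ m\<close> and applying Hoelder's inequality in the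
  \<open>m\<close>-tuple of points reduces the estimate, on an interval of length \<open>M = 2 * N\<close>, to bounding the number
  of complete bipartite configurations \<open>(x\<^sub>1, \<dots>, x\<^sub>m, y\<^sub>1, \<dots>, y\<^sub>m)\<close> with all \<open>x\<^sub>a - y\<^sub>b\<close> prime by
  \<open>O(M\<^sup>2\<^sup>m / (ln M) ^ m\<^sup>2)\<close>. This is an upper bound sieve of dimension \<open>\<kappa> = m\<^sup>2\<close>. The functions
  \<open>\<Sum>a b. 1 / p - [p dvd x\<^sub>a - y\<^sub>b]\<close> have mean zero and variance at most \<open>\<kappa> / p\<close> modulo \<open>p\<close>, are
  independent for different primes, and equal \<open>\<kappa> / p\<close> on the sifted configurations; the sum of their products over
  squarefree moduli up to a small power of \<open>M\<close> therefore detects these configurations with the right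
  density. Intervals of length \<open>N\<close> are then summed using \<open>p' \<ge> p\<close>.\<close>

subsection \<open>Sums over primes\<close>

text \<open>The obstacle is the endpoint \<open>p = 1\<close>: the kernel is as large as
  \<open>ln N / N\<close>, so interpolation with the trivial bound would leave a power of
  \<open>ln N\<close>. An integer \<open>m > p'\<close> replaces that endpoint, and there the
  logarithms balance exactly. A configuration involves \<open>m^2\<close> differences, each weighted
  by about \<open>ln M / N\<close>, and the sieve saves a factor \<open>1 / ln M\<close> for each of
  them. Modulo \<open>p\<close>, the \<open>m^2\<close> divisibility events are dependent: along a
  cycle of the bipartite graph, one congruence follows from the others. Any two distinct events are
  nevertheless uncorrelated, and a second moment sees nothing more. Since the value at a sifted
  point and the variance bound are both \<open>\<kappa> / p\<close>, the detecting sum takes the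
  value \<open>L\<close> at sifted points while its mean square is \<open>O(L)\<close>. Sifted
  points thus have density \<open>O(1 / L)\<close>, where \<open>L\<close> is at least of order
  \<open>(ln M)\<close> to the power \<open>\<kappa>\<close>.\<close>

lemma prod_primes_dvd:
  fixes n :: nat
  assumes "finite S" "\<And>p. p \<in> S \<Longrightarrow> prime p" "\<And>p. p \<in> S \<Longrightarrow> p dvd n"
  shows "\<Prod>S dvd n"
  using assms
proof (induction S rule: finite_induct)
  case (insert p S)
  have "coprime p (\<Prod>S)"
    using insert by (intro prod_coprime_right) (auto intro!: primes_coprime)
  then show ?case
    using insert by (simp add: divides_mult)
qed simp

lemma inj_on_prod_primes:
  fixes P :: "nat set"
  assumes "finite P" "\<And>p. p \<in> P \<Longrightarrow> prime p"
  shows "inj_on (\<lambda>S. \<Prod>S) (Pow P)"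
proof (rule inj_onI)
  have *: "prime_factors (\<Prod>S) = S" if "S \<in> Pow P" for S
  proof -
    have "finite S" using that assms(1) finite_subset by auto
    moreover have prime: "prime p" if "p \<in> S" for p using \<open>S \<in> Pow P\<close> that assms(2) by auto
    moreover have "0 \<notin> S" using prime not_prime_0 by metis
    ultimately have "prime_factors (\<Prod>S) = (\<Union>p\<in>S. prime_factors p)"
      by (subst prime_factors_prod) (auto simp: comp_def)
    also have "\<dots> = (\<Union>p\<in>S. {p})" using prime by (simp add: prime_factorization_prime)
    finally show ?thesis by simp
  qed
  show "S = T" if "S \<in> Pow P" "T \<in> Pow P" "\<Prod>S = \<Prod>T" for S T
    using *[OF that(1)] *[OF that(2)] that(3) by metis
qed

text \<open>An upper bound of Mertens type by double counting: the primes dividing \<open>k\<close>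
  have product at most \<open>k\<close>, and a prime \<open>p \<le> n\<close> divides at least
  \<open>n / (2 p)\<close> of the integers up to \<open>n\<close>.\<close>

lemma sum_ln_prime_over_prime_le:
  assumes "n \<ge> 1"
  shows "(\<Sum>p | prime p \<and> p \<le> n. ln (real p) / real p) \<le> 2 * ln (real n)"
proof -
  let ?P = "{p. prime p \<and> p \<le> n}"
  have finP: "finite ?P" by (rule finite_subset[of _ "{..n}"]) auto
  have ln_le: "(\<Sum>p | prime p \<and> p \<le> n \<and> p dvd k. ln (real p)) \<le> ln (real n)" if "k \<in> {1..n}" for k
  proof -
    let ?S = "{p. prime p \<and> p \<le> n \<and> p dvd k}"
    have fin: "finite ?S" by (rule finite_subset[OF _ finP]) auto
    have "(\<Sum>p\<in>?S. ln (real p)) = ln (\<Prod>p\<in>?S. real p)"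
      using fin by (subst ln_prod) (auto simp: prime_gt_0_nat)
    also have "(\<Prod>p\<in>?S. real p) = real (\<Prod>?S)" by simp
    finally have eq: "(\<Sum>p\<in>?S. ln (real p)) = ln (real (\<Prod>?S))" .
    have "\<Prod>?S dvd k" using fin by (intro prod_primes_dvd) auto
    then have "\<Prod>?S \<le> n" using that by (auto dest: dvd_imp_le)
    moreover have "0 < \<Prod>?S" using fin by (intro prod_pos) (auto simp: prime_gt_0_nat)
    ultimately have "ln (real (\<Prod>?S)) \<le> ln (real n)" by (subst ln_le_cancel_iff) (auto simp del: of_nat_prod)
    then show ?thesis using eq by simp
  qed
  have card: "real n / (2 * real p) \<le> real (card {k\<in>{1..n}. p dvd k})" if "p \<in> ?P" for p
  proof -
    have p: "p \<ge> 1" "p \<le> n" using that prime_ge_1_nat by auto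
    have "(\<lambda>i. p * i) ` {1..n div p} \<subseteq> {k\<in>{1..n}. p dvd k}"
      using p by (auto simp: less_eq_div_iff_mult_less_eq mult.commute)
    then have "card ((\<lambda>i. p * i) ` {1..n div p}) \<le> card {k\<in>{1..n}. p dvd k}"
      by (intro card_mono) auto
    also have "card ((\<lambda>i. p * i) ` {1..n div p}) = n div p"
      using p by (subst card_image) (auto simp: inj_on_def)
    finally have le: "n div p \<le> card {k\<in>{1..n}. p dvd k}" .
    \<comment> \<open>As the quotient is at least 1, the remainder is less than
      \<open>p * (n div p)\<close>; rounding down loses at most a factor 2.\<close>
    have "1 \<le> n div p" using p by (simp add: less_eq_div_iff_mult_less_eq)
    then have "p * 1 \<le> p * (n div p)" by simp
    moreover have "n mod p < p" using p by simp
    ultimately have "n \<le> 2 * (p * (n div p))" using mult_div_mod_eq[of p n] by linarith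
    then have "real n \<le> 2 * real p * real (n div p)" by (metis mult.assoc of_nat_le_iff of_nat_mult of_nat_numeral)
    then have "real n / (2 * real p) \<le> real (n div p)" using p by (simp add: field_simps)
    then show ?thesis using le by linarith
  qed
  have "real n / 2 * (\<Sum>p\<in>?P. ln (real p) / real p) = (\<Sum>p\<in>?P. real n / (2 * real p) * ln (real p))"
    by (simp add: sum_distrib_left)
  also have "\<dots> \<le> (\<Sum>p\<in>?P. real (card {k\<in>{1..n}. p dvd k}) * ln (real p))"
    using card by (intro sum_mono mult_right_mono) (auto intro!: ln_ge_zero simp: prime_ge_Suc_0_nat)
  also have "\<dots> = (\<Sum>p\<in>?P. \<Sum>k | k \<in> {1..n} \<and> p dvd k. ln (real p))" by simp
  also have "\<dots> = (\<Sum>k\<in>{1..n}. \<Sum>p | p \<in> ?P \<and> p dvd k. ln (real p))"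
    using finP by (subst sum.swap_restrict) auto
  also have "\<dots> \<le> (\<Sum>k\<in>{1..n}. ln (real n))"
    using ln_le by (intro sum_mono) (simp add: conj_assoc)
  finally show ?thesis using assms by (simp add: field_simps)
qed

lemma sum_inverse_squares_le:
  "(\<Sum>d=1..n. 1 / real d ^ 2) \<le> 2"
proof -
  have "(\<Sum>d=1..n. 1 / real d ^ 2) \<le> 2 - 1 / real n" if "n \<ge> 1"
    using that
  proof (induction n rule: dec_induct)
    case (step n)
    have "1 / real (Suc n) ^ 2 \<le> 1 / (real n * real (Suc n))"
      using step by (intro divide_left_mono) (auto simp: power2_eq_square)
    also have "\<dots> = 1 / real n - 1 / real (Suc n)" using step by (simp add: field_simps)
    finally show ?case using step by simp
  qed simp
  moreover have "2 - 1 / real n \<le> 2" by simp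
  ultimately show ?thesis by (cases "n \<ge> 1") (blast intro: order.trans, simp)
qed

text \<open>Writing \<open>k = q d^2\<close> with \<open>q\<close> squarefree bounds the harmonic
  sum by the sum of \<open>1 / q\<close> times the sum of \<open>1 / d^2\<close>. The latter is at
  most 2, the source of the half; the former is part of the expanded Euler product, and
  \<open>1 + x \<le> exp x\<close> finishes.\<close>

lemma half_ln_le_exp_sum_inverse_primes:
  assumes "n \<ge> 1"
  shows "ln (real n) / 2 \<le> exp (\<Sum>p | prime p \<and> p \<le> n. 1 / real p)"
proof -
  let ?P = "{p. prime p \<and> p \<le> n}"
  have finP: "finite ?P" by (rule finite_subset[of _ "{..n}"]) auto
  define T where "T = {q\<in>{1..n}. squarefree q}"
  have finT: "finite T" unfolding T_def by auto
  have "ln (real n) \<le> ln (real n + 1)" using assms by simp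
  also have "\<dots> \<le> harm n" by (rule ln_le_harm)
  also have "\<dots> = (\<Sum>k=1..n. 1 / real k)" by (simp add: harm_def field_simps)
  also have "\<dots> \<le> (\<Sum>(q,d)\<in>T \<times> {1..n}. 1 / (real q * real d ^ 2))"
  proof (rule sum_le_included[where i = "\<lambda>(q,d). q * d ^ 2"])
    show "\<forall>k\<in>{1..n}. \<exists>y\<in>T \<times> {1..n}. (case y of (q, d) \<Rightarrow> q * d ^ 2) = k \<and>
            1 / real k \<le> (case y of (q, d) \<Rightarrow> 1 / (real q * real d ^ 2))"
    proof
      fix k assume k: "k \<in> {1..n}"
      let ?q = "squarefree_part k" and ?d = "square_part k"
      have dec: "k = ?q * ?d ^ 2" by (rule squarefree_decompose)
      have pos: "?q > 0" "?d > 0" using k by (auto intro!: Nat.gr0I)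
      have "?q dvd k" "?d dvd k" using dec by (metis dvd_triv_left, metis dvd_mult dvd_power zero_less_numeral)
      then have "?q \<le> n" "?d \<le> n" using k by (auto dest!: dvd_imp_le)
      then have mem: "(?q, ?d) \<in> T \<times> {1..n}" using pos by (auto simp: T_def Suc_le_eq)
      have "real k = real ?q * real ?d ^ 2" by (subst dec) simp
      then show "\<exists>y\<in>T \<times> {1..n}. (case y of (q, d) \<Rightarrow> q * d ^ 2) = k \<and>
            1 / real k \<le> (case y of (q, d) \<Rightarrow> 1 / (real q * real d ^ 2))"
        using mem dec by (intro bexI[of _ "(?q, ?d)"]) auto
    qed
  qed (use finT in auto)
  also have "\<dots> = (\<Sum>q\<in>T. 1 / real q) * (\<Sum>d=1..n. 1 / real d ^ 2)"
    by (simp add: sum_product sum.cartesian_product)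
  also have "\<dots> \<le> (\<Sum>q\<in>T. 1 / real q) * 2"
    by (intro mult_left_mono sum_inverse_squares_le sum_nonneg) auto
  also have "(\<Sum>q\<in>T. 1 / real q) \<le> (\<Sum>S\<in>Pow ?P. \<Prod>p\<in>S. 1 / real p)"
  proof (rule sum_le_included[where i = "\<lambda>S. \<Prod>S"])
    show "\<forall>q\<in>T. \<exists>S\<in>Pow ?P. \<Prod>S = q \<and> 1 / real q \<le> (\<Prod>p\<in>S. 1 / real p)"
    proof
      fix q assume q: "q \<in> T"
      have "q = (\<Prod>p\<in>prime_factors q. p ^ multiplicity p q)"
        using q by (subst prod_prime_factors) (auto simp: T_def)
      also have "\<dots> = \<Prod>(prime_factors q)"
      proof (rule prod.cong[OF refl])
        fix p assume p: "p \<in> prime_factors q"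
        then have "multiplicity p q > 0" by (simp add: prime_factors_multiplicity)
        moreover have "squarefree q" "prime p" using q p by (auto simp: T_def in_prime_factors_iff)
        then have "multiplicity p q \<le> 1"
          using squarefree_factorial_semiring''[of q] by (cases "q = 0") auto
        ultimately show "p ^ multiplicity p q = p" by (metis One_nat_def le_antisym Suc_leI power_one_right)
      qed
      finally have eq: "\<Prod>(prime_factors q) = q" by simp
      have "prime_factors q \<in> Pow ?P"
        using q by (auto simp: T_def prime_factors_dvd dest!: dvd_imp_le)
      moreover have "(\<Prod>p\<in>prime_factors q. 1 / real p) = 1 / real (\<Prod>(prime_factors q))"
        by (simp add: prod_dividef)
      ultimately show "\<exists>S\<in>Pow ?P. \<Prod>S = q \<and> 1 / real q \<le> (\<Prod>p\<in>S. 1 / real p)"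
        using eq by (intro bexI[of _ "prime_factors q"]) auto
    qed
  qed (use finP finT in \<open>auto intro!: prod_nonneg\<close>)
  also have "\<dots> = (\<Prod>p\<in>?P. 1 / real p + 1)"
    using finP by (subst prod_add) auto
  also have "\<dots> \<le> (\<Prod>p\<in>?P. exp (1 / real p))"
    by (intro prod_mono) (auto simp: add.commute[of _ 1] intro!: add_nonneg_nonneg)
  also have "\<dots> = exp (\<Sum>p\<in>?P. 1 / real p)" using finP by (simp add: exp_sum)
  finally show ?thesis by simp
qed

section \<open>Sieve densities and their truncated Euler product\<close>

definition sieve_density :: "nat \<Rightarrow> nat set \<Rightarrow> real" where
  "sieve_density \<kappa> S = (\<Prod>p\<in>S. real \<kappa> / real p)"

text \<open>Squarefree moduli are encoded by their sets of prime factors. Primes below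
  \<open>\<kappa>\<close> are left out for two reasons: \<open>\<kappa> / p \<le> 1\<close> permits
  a quadratic lower bound for the logarithm, and functions bounded by
  \<open>\<kappa> \<le> p\<close> for each \<open>p\<close> in \<open>S\<close> have a product
  bounded by \<open>\<Prod>S \<le> Q\<close>.\<close>

definition sieve_support :: "nat \<Rightarrow> nat \<Rightarrow> nat \<Rightarrow> nat set set" where
  "sieve_support \<kappa> z Q = {S. S \<subseteq> {p. prime p \<and> \<kappa> \<le> p \<and> p \<le> z} \<and> \<Prod>S \<le> Q}"

text \<open>On taking logarithms, \<open>ln (1 + x) \<ge> x - x^2\<close> applies with
  \<open>x = \<kappa> / p \<le> 1\<close>. The loss \<open>3 \<kappa>^2\<close> consists of
  \<open>\<kappa>\<close> times \<open>\<kappa>\<close> for the missing primes below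
  \<open>\<kappa>\<close>, where \<open>1 / p \<le> 1\<close>, and \<open>2 \<kappa>^2\<close> for
  the quadratic terms.\<close>

lemma prod_sieve_range_ge:
  assumes "n \<ge> 2" "\<kappa> \<ge> 1"
  shows "exp (- 3 * real \<kappa> ^ 2) * (ln (real n) / 2) ^ \<kappa>
           \<le> (\<Prod>p | prime p \<and> \<kappa> \<le> p \<and> p \<le> n. 1 + real \<kappa> / real p)"
proof -
  let ?P = "{p. prime p \<and> p \<le> n}"
  let ?R = "{p. prime p \<and> \<kappa> \<le> p \<and> p \<le> n}"
  have finP: "finite ?P" by (rule finite_subset[of _ "{..n}"]) auto
  have finR: "finite ?R" by (rule finite_subset[OF _ finP]) auto
  have pos: "ln (real n) / 2 > 0" using assms by simp
  have "ln (ln (real n) / 2) \<le> (\<Sum>p\<in>?P. 1 / real p)"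
    using half_ln_le_exp_sum_inverse_primes[of n] assms pos
    by (metis ln_exp ln_le_cancel_iff exp_gt_zero le_trans one_le_numeral)
  also have "\<dots> = (\<Sum>p\<in>?R. 1 / real p) + (\<Sum>p\<in>?P - ?R. 1 / real p)"
    using finP by (subst sum.subset_diff[of ?R ?P]) auto
  also have "(\<Sum>p\<in>?P - ?R. 1 / real p) \<le> (\<Sum>p\<in>{..<\<kappa>}. 1)"
    by (intro sum_le_included[where i = id]) (auto simp: prime_gt_0_nat Suc_le_eq finP)
  finally have S1: "ln (ln (real n) / 2) - real \<kappa> \<le> (\<Sum>p\<in>?R. 1 / real p)" by simp
  have S2: "(\<Sum>p\<in>?R. 1 / real p ^ 2) \<le> 2"
  proof -
    have "(\<Sum>p\<in>?R. 1 / real p ^ 2) \<le> (\<Sum>d=1..n. 1 / real d ^ 2)"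
      by (intro sum_mono2) (auto simp: prime_ge_Suc_0_nat)
    then show ?thesis using sum_inverse_squares_le[of n] by linarith
  qed
  have "real \<kappa> * ln (ln (real n) / 2) - 3 * real \<kappa> ^ 2 =
          real \<kappa> * (ln (ln (real n) / 2) - real \<kappa>) - real \<kappa> ^ 2 * 2"
    by (simp add: algebra_simps power2_eq_square)
  also have "\<dots> \<le> real \<kappa> * (\<Sum>p\<in>?R. 1 / real p) - real \<kappa> ^ 2 * (\<Sum>p\<in>?R. 1 / real p ^ 2)"
    by (intro diff_mono mult_left_mono S1 S2) auto
  also have "\<dots> = (\<Sum>p\<in>?R. real \<kappa> / real p - (real \<kappa> / real p) ^ 2)"
    by (simp add: sum_distrib_left sum_subtractf power_divide)
  also have "\<dots> \<le> (\<Sum>p\<in>?R. ln (1 + real \<kappa> / real p))"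
    by (intro sum_mono ln_one_plus_pos_lower_bound) (auto simp: divide_le_eq)
  also have "\<dots> = ln (\<Prod>p\<in>?R. 1 + real \<kappa> / real p)"
    using finR by (subst ln_prod) (auto intro!: add_pos_nonneg simp: add_nonneg_eq_0_iff)
  finally have "exp (real \<kappa> * ln (ln (real n) / 2) - 3 * real \<kappa> ^ 2) \<le> exp \<dots>"
    by simp
  also have "\<dots> = (\<Prod>p\<in>?R. 1 + real \<kappa> / real p)"
    by (intro exp_ln prod_pos) (auto intro!: add_pos_nonneg)
  also have "exp (real \<kappa> * ln (ln (real n) / 2) - 3 * real \<kappa> ^ 2) =
      exp (- 3 * real \<kappa> ^ 2) * (ln (real n) / 2) ^ \<kappa>"
    using pos by (simp add: exp_diff exp_of_nat_mult exp_minus field_simps)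
  finally show ?thesis .
qed

text \<open>Rankin's trick with exponent \<open>1 / ln z\<close>: truncating the Euler product at \<open>z ^ (4 \<kappa> + 1)\<close>
  loses at most half of it.\<close>

lemma sum_sieve_density_ge:
  assumes "z \<ge> 2" "\<kappa> \<ge> 1"
  shows "exp (- 3 * real \<kappa> ^ 2) / 2 * (ln (real z) / 2) ^ \<kappa>
           \<le> (\<Sum>S\<in>sieve_support \<kappa> z (z ^ (4 * \<kappa> + 1)). sieve_density \<kappa> S)"
proof -
  let ?R = "{p. prime p \<and> \<kappa> \<le> p \<and> p \<le> z}"
  have finR: "finite ?R" by (rule finite_subset[of _ "{..z}"]) auto
  \<comment> \<open>The twist by \<open>p powr \<eta>\<close> inflates the Euler product by at most
    \<open>exp (4 \<kappa>)\<close>: one factor 2 comes from \<open>exp t \<le> 1 + 2 t\<close>, the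
    other from the Mertens bound. The extra 1 leaves \<open>exp (-1) \<le> 1 / 2\<close>.\<close>
  define u where "u = 4 * \<kappa> + 1"
  define \<eta> where "\<eta> = 1 / ln (real z)"
  have lnz: "ln (real z) > 0" using assms by simp
  then have \<eta>: "\<eta> > 0" by (simp add: \<eta>_def)
  define W where "W = (\<Prod>p\<in>?R. 1 + real \<kappa> / real p)"
  have Wpos: "W > 0" unfolding W_def by (intro prod_pos) (auto intro!: add_pos_nonneg)
  let ?D = "sieve_support \<kappa> z (z ^ u)"
  have D: "?D = {S \<in> Pow ?R. \<Prod>S \<le> z ^ u}" by (auto simp: sieve_support_def)
  have Wsum: "W = (\<Sum>S\<in>Pow ?R. sieve_density \<kappa> S)"
    unfolding W_def sieve_density_def using finR
    by (subst add.commute) (subst prod_add, auto)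
  \<comment> \<open>This form splits off the untwisted factor, which multiplies up to
    \<open>W\<close>, and leaves an exponent proportional to \<open>ln p / p\<close>.\<close>
  have g1: "1 + real \<kappa> / real p * real p powr \<eta> \<le>
         (1 + real \<kappa> / real p) * exp (2 * real \<kappa> * \<eta> * (ln (real p) / real p))" if "p \<in> ?R" for p
  proof -
    have p: "p \<ge> 1" "p \<le> z" using that prime_ge_1_nat by auto
    define t where "t = \<eta> * ln (real p)"
    have t0: "0 \<le> t" using \<eta> p by (auto simp: t_def)
    have "ln (real p) \<le> ln (real z)" using p by (subst ln_le_cancel_iff) auto
    then have t1: "t \<le> 1" using lnz by (simp add: t_def \<eta>_def field_simps)
    have "real p powr \<eta> = exp t" using p by (simp add: powr_def t_def)
    also have "\<dots> \<le> 1 + t + t ^ 2" using t0 t1 by (rule exp_bound)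
    also have "t ^ 2 \<le> t" using t0 t1 by (simp add: power2_eq_square mult_left_le)
    finally have pw: "real p powr \<eta> \<le> 1 + 2 * t" by simp
    define g where "g = real \<kappa> / real p"
    have g: "g \<ge> 0" by (simp add: g_def)
    have "1 + g * real p powr \<eta> \<le> 1 + g * (1 + 2 * t)" using pw g by (intro add_left_mono mult_left_mono)
    also have "\<dots> \<le> (1 + g) * (1 + 2 * t * g)" using g t0 by (simp add: algebra_simps)
    also have "\<dots> \<le> (1 + g) * exp (2 * t * g)" using g by (intro mult_left_mono exp_ge_add_one_self) auto
    also have "2 * t * g = 2 * real \<kappa> * \<eta> * (ln (real p) / real p)" by (simp add: t_def g_def)
    finally show ?thesis unfolding g_def .
  qed
  have "(\<Sum>S\<in>Pow ?R - ?D. sieve_density \<kappa> S)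
      \<le> (\<Sum>S\<in>Pow ?R - ?D. exp (- real u) * (\<Prod>p\<in>S. real \<kappa> / real p * real p powr \<eta>))"
  proof (rule sum_mono)
    fix S assume S: "S \<in> Pow ?R - ?D"
    have finS: "finite S" using S finR by (meson DiffD1 PowD finite_subset)
    \<comment> \<open>Outside the support \<open>\<Prod>S > z ^ u\<close>, and \<open>\<eta>\<close>
      is chosen so that \<open>z powr \<eta>\<close> is \<open>exp 1\<close>.\<close>
    have "exp (real u) = real (z ^ u) powr \<eta>"
      using assms lnz by (simp add: powr_def \<eta>_def ln_realpow)
    also have "\<dots> \<le> real (\<Prod>S) powr \<eta>"
      using S \<eta> unfolding D by (intro powr_mono2) (auto simp del: of_nat_power of_nat_prod)
    also have "\<dots> = (\<Prod>p\<in>S. real p powr \<eta>)"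
      by (simp add: prod_powr_distrib)
    finally have ge: "exp (real u) \<le> (\<Prod>p\<in>S. real p powr \<eta>)" .
    have "sieve_density \<kappa> S = exp (- real u) * (sieve_density \<kappa> S * exp (real u))" by (simp add: exp_minus)
    also have "\<dots> \<le> exp (- real u) * (sieve_density \<kappa> S * (\<Prod>p\<in>S. real p powr \<eta>))"
      using ge by (intro mult_left_mono) (auto simp: sieve_density_def intro!: prod_nonneg)
    finally show "sieve_density \<kappa> S \<le> exp (- real u) * (\<Prod>p\<in>S. real \<kappa> / real p * real p powr \<eta>)"
      by (simp only: sieve_density_def prod.distrib)
  qed
  also have "\<dots> \<le> (\<Sum>S\<in>Pow ?R. exp (- real u) * (\<Prod>p\<in>S. real \<kappa> / real p * real p powr \<eta>))"
    using finR by (intro sum_mono2) (auto intro!: mult_nonneg_nonneg prod_nonneg)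
  also have "\<dots> = exp (- real u) * (\<Prod>p\<in>?R. 1 + real \<kappa> / real p * real p powr \<eta>)"
    using finR by (subst add.commute) (subst prod_add, auto simp: sum_distrib_left)
  also have "\<dots> \<le> exp (- real u) * (\<Prod>p\<in>?R. (1 + real \<kappa> / real p) * exp (2 * real \<kappa> * \<eta> * (ln (real p) / real p)))"
    using g1 by (intro mult_left_mono prod_mono) (auto intro!: add_nonneg_nonneg)
  also have "\<dots> = exp (- real u) * W * exp (2 * real \<kappa> * \<eta> * (\<Sum>p\<in>?R. ln (real p) / real p))"
    using finR by (simp add: W_def prod.distrib exp_sum sum_distrib_left)
  also have "\<dots> \<le> exp (- real u) * W * exp (4 * real \<kappa>)"
  proof -
    have "(\<Sum>p\<in>?R. ln (real p) / real p) \<le> (\<Sum>p | prime p \<and> p \<le> z. ln (real p) / real p)"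
      by (intro sum_mono2 finite_subset[of "{p. prime p \<and> p \<le> z}" "{..z}"]) (auto intro!: divide_nonneg_nonneg ln_ge_zero simp: prime_ge_Suc_0_nat)
    also have "\<dots> \<le> 2 * ln (real z)" using assms by (intro sum_ln_prime_over_prime_le) auto
    finally have "2 * real \<kappa> * \<eta> * (\<Sum>p\<in>?R. ln (real p) / real p) \<le> 2 * real \<kappa> * \<eta> * (2 * ln (real z))"
      using \<eta> by (intro mult_left_mono) auto
    also have "\<dots> = 4 * real \<kappa>" using lnz by (simp add: \<eta>_def)
    finally show ?thesis using Wpos by (intro mult_left_mono) auto
  qed
  also have "\<dots> = W * exp (-1)" by (simp add: u_def mult.assoc mult.left_commute flip: exp_add)
  also have "\<dots> \<le> W * (1 / 2)"
  proof -
    have "(2::real) \<le> exp 1" using exp_ge_add_one_self[of 1] by simp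
    then show ?thesis using Wpos by (intro mult_left_mono) (auto simp: exp_minus field_simps)
  qed
  finally have tail: "(\<Sum>S\<in>Pow ?R - ?D. sieve_density \<kappa> S) \<le> W / 2" by simp
  have "W = (\<Sum>S\<in>?D. sieve_density \<kappa> S) + (\<Sum>S\<in>Pow ?R - ?D. sieve_density \<kappa> S)"
    unfolding Wsum using finR by (subst sum.subset_diff[of ?D "Pow ?R"]) (auto simp: D)
  then have "W / 2 \<le> (\<Sum>S\<in>?D. sieve_density \<kappa> S)" using tail by simp
  moreover have "exp (- 3 * real \<kappa> ^ 2) * (ln (real z) / 2) ^ \<kappa> \<le> W"
    unfolding W_def by (rule prod_sieve_range_ge[OF assms])
  ultimately show ?thesis unfolding u_def by simp
qed

subsection \<open>Periodic functions on cubes\<close>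

definition cube :: "'v set \<Rightarrow> nat \<Rightarrow> ('v \<Rightarrow> int) set" where
  "cube V M = PiE V (\<lambda>_. {0..<int M})"

text \<open>Quantifying over all functions makes \<open>F\<close> independent of coordinates outside
  \<open>V\<close>; an argument may therefore be reduced modulo \<open>e\<close> and restricted to
  \<open>V\<close> at the same time.\<close>

definition periodic_on :: "'v set \<Rightarrow> nat \<Rightarrow> (('v \<Rightarrow> int) \<Rightarrow> real) \<Rightarrow> bool" where
  "periodic_on V e F \<longleftrightarrow> (\<forall>z z'. (\<forall>v\<in>V. int e dvd z v - z' v) \<longrightarrow> F z = F z')"

lemma finite_cube: "finite V \<Longrightarrow> finite (cube V M)"
  unfolding cube_def by (intro finite_PiE) auto

lemma card_cube: "finite V \<Longrightarrow> card (cube V M) = M ^ card V"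
  unfolding cube_def by (simp add: card_PiE)

lemma cube_mono: "M \<le> M' \<Longrightarrow> cube V M \<subseteq> cube V M'"
  unfolding cube_def by (intro PiE_mono) auto

lemma periodic_onD:
  "periodic_on V e F \<Longrightarrow> (\<And>v. v \<in> V \<Longrightarrow> int e dvd z v - z' v) \<Longrightarrow> F z = F z'"
  unfolding periodic_on_def by blast

lemma periodic_on_dvd: "periodic_on V e F \<Longrightarrow> e dvd e' \<Longrightarrow> periodic_on V e' F"
  unfolding periodic_on_def by (meson dvd_trans int_dvd_int_iff)

lemma periodic_on_const [simp]: "periodic_on V e (\<lambda>_. c)"
  by (simp add: periodic_on_def)

lemma periodic_on_mult:
  "periodic_on V e F \<Longrightarrow> periodic_on V e G \<Longrightarrow> periodic_on V e (\<lambda>z. F z * G z)"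
  unfolding periodic_on_def by metis

lemma periodic_on_prod:
  assumes "finite U" "\<And>p. p \<in> U \<Longrightarrow> periodic_on V p (\<phi> p)"
  shows "periodic_on V (\<Prod>U) (\<lambda>z. \<Prod>p\<in>U. \<phi> p z)"
proof -
  have "periodic_on V (\<Prod>U) (\<phi> p)" if "p \<in> U" for p
    using that assms by (intro periodic_on_dvd[OF assms(2)] dvd_prodI[of U p id, simplified]) auto
  then show ?thesis
    unfolding periodic_on_def by (intro allI impI prod.cong) auto
qed

lemma sum_PiE_insert:
  assumes "w \<notin> V"
  shows "sum F (PiE (insert w V) T) = (\<Sum>g\<in>PiE V T. \<Sum>t\<in>T w. F (g(w := t)))"
proof -
  have "sum F (PiE (insert w V) T) = (\<Sum>(t, g)\<in>T w \<times> PiE V T. F (g(w := t)))"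
    unfolding PiE_insert_eq using assms
    by (subst sum.reindex) (auto simp: inj_combinator comp_def case_prod_beta)
  also have "\<dots> = (\<Sum>t\<in>T w. \<Sum>g\<in>PiE V T. F (g(w := t)))"
    by (simp add: sum.cartesian_product)
  also have "\<dots> = (\<Sum>g\<in>PiE V T. \<Sum>t\<in>T w. F (g(w := t)))"
    by (rule sum.swap)
  finally show ?thesis .
qed

lemma sum_cube_coordinate:
  assumes "w \<in> V"
  shows "sum F (cube V M) = (\<Sum>g\<in>cube (V - {w}) M. \<Sum>t\<in>{0..<int M}. F (g(w := t)))"
  using sum_PiE_insert[of w "V - {w}" F "\<lambda>_. {0..<int M}"] assms
  by (simp add: cube_def insert_absorb)

text \<open>A bijection of one coordinate with a pair acts on all coordinates at once. It serves two
  purposes: residues modulo coprime \<open>a\<close> and \<open>b\<close> (independence), and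
  remainder with quotient (tiling by full periods).\<close>

lemma sum_PiE_bij_prod:
  fixes F :: "('v \<Rightarrow> 'b) \<Rightarrow> real"
  assumes bij: "bij_betw (\<lambda>x. (\<alpha> x, \<beta> x)) X (Y \<times> Z)"
  shows "(\<Sum>z\<in>PiE V (\<lambda>_. X). F (\<lambda>v\<in>V. \<alpha> (z v)) * G (\<lambda>v\<in>V. \<beta> (z v))) =
           sum F (PiE V (\<lambda>_. Y)) * sum G (PiE V (\<lambda>_. Z))"
proof -
  define h where "h = inv_into X (\<lambda>x. (\<alpha> x, \<beta> x))"
  have h: "h y \<in> X" "\<alpha> (h y) = fst y" "\<beta> (h y) = snd y" if "y \<in> Y \<times> Z" for y
    using bij_betw_inv_into_right[OF bij that] that bij_betw_imp_surj_on[OF bij]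
    by (auto simp: h_def intro: inv_into_into prod_eqI)
  have h': "h (\<alpha> x, \<beta> x) = x" "\<alpha> x \<in> Y" "\<beta> x \<in> Z" if "x \<in> X" for x
    using bij_betw_inv_into_left[OF bij that] that bij_betw_imp_surj_on[OF bij]
    by (auto simp: h_def)
  have "bij_betw (\<lambda>z. (\<lambda>v\<in>V. \<alpha> (z v), \<lambda>v\<in>V. \<beta> (z v))) (PiE V (\<lambda>_. X))
          (PiE V (\<lambda>_. Y) \<times> PiE V (\<lambda>_. Z))"
  proof (rule bij_betw_byWitness[where f' = "\<lambda>(f, g). \<lambda>v\<in>V. h (f v, g v)"])
    show "\<forall>z\<in>PiE V (\<lambda>_. X). (\<lambda>(f, g). \<lambda>v\<in>V. h (f v, g v)) (\<lambda>v\<in>V. \<alpha> (z v), \<lambda>v\<in>V. \<beta> (z v)) = z"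
      using h' by (auto intro!: ext simp: PiE_def Pi_def extensional_def restrict_def)
    show "\<forall>y\<in>PiE V (\<lambda>_. Y) \<times> PiE V (\<lambda>_. Z).
        (\<lambda>z. (\<lambda>v\<in>V. \<alpha> (z v), \<lambda>v\<in>V. \<beta> (z v))) ((\<lambda>(f, g). \<lambda>v\<in>V. h (f v, g v)) y) = y"
      using h by (auto intro!: ext simp: PiE_def Pi_def extensional_def restrict_def)
  qed (use h h' in \<open>auto simp: PiE_def Pi_def extensional_def\<close>)
  then have "(\<Sum>z\<in>PiE V (\<lambda>_. X). (\<lambda>(f, g). F f * G g) (\<lambda>v\<in>V. \<alpha> (z v), \<lambda>v\<in>V. \<beta> (z v))) =
      (\<Sum>y\<in>PiE V (\<lambda>_. Y) \<times> PiE V (\<lambda>_. Z). (\<lambda>(f, g). F f * G g) y)"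
    by (rule sum.reindex_bij_betw)
  also have "\<dots> = sum F (PiE V (\<lambda>_. Y)) * sum G (PiE V (\<lambda>_. Z))"
    by (simp add: sum_product sum.cartesian_product)
  finally show ?thesis by simp
qed

lemma bij_betw_mod_mod:
  assumes "coprime a b" "a > 0" "b > 0"
  shows "bij_betw (\<lambda>x. (x mod int a, x mod int b)) {0..<int (a * b)} ({0..<int a} \<times> {0..<int b})"
proof -
  let ?f = "\<lambda>x. (x mod int a, x mod int b)"
  have inj: "inj_on ?f {0..<int (a * b)}"
  proof (rule inj_onI)
    fix x y assume xy: "x \<in> {0..<int (a * b)}" "y \<in> {0..<int (a * b)}" "?f x = ?f y"
    have "int a dvd x - y" "int b dvd x - y" using xy by (auto simp: mod_eq_dvd_iff)
    then have "int (a * b) dvd x - y"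
      using assms(1) by (simp add: divides_mult)
    then have "x mod int (a * b) = y mod int (a * b)" by (simp add: mod_eq_dvd_iff)
    then show "x = y" using xy by simp
  qed
  have sub: "?f ` {0..<int (a * b)} \<subseteq> {0..<int a} \<times> {0..<int b}"
    using assms by auto
  have "?f ` {0..<int (a * b)} = {0..<int a} \<times> {0..<int b}"
    using inj sub by (intro card_subset_eq) (auto simp: card_image card_cartesian_product nat_mult_distrib)
  with inj show ?thesis by (simp add: bij_betw_def)
qed

lemma bij_betw_mod_div:
  assumes "e > 0"
  shows "bij_betw (\<lambda>x. (x mod int e, x div int e)) {0..<int (k * e)} ({0..<int e} \<times> {0..<int k})"
proof (rule bij_betw_byWitness[where f' = "\<lambda>(r, q). q * int e + r"])
  have "q * int e + r < int k * int e" if "r < int e" "q < int k" for q r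
  proof -
    have "q * int e + r < (q + 1) * int e" using that by (simp add: algebra_simps)
    also have "\<dots> \<le> int k * int e" using that by (intro mult_right_mono) auto
    finally show ?thesis .
  qed
  then show "(\<lambda>(r, q). q * int e + r) ` ({0..<int e} \<times> {0..<int k}) \<subseteq> {0..<int (k * e)}"
    by auto
  have "x div int e < int k" if "x < int k * int e" for x
    using that assms by (smt (verit) mult_right_mono mult_div_mod_eq mult.commute pos_mod_sign of_nat_0_less_iff)
  then show "(\<lambda>x. (x mod int e, x div int e)) ` {0..<int (k * e)} \<subseteq> {0..<int e} \<times> {0..<int k}"
    using assms by (auto simp: pos_imp_zdiv_nonneg_iff)
qed (use assms in auto)

lemma sum_cube_mult_coprime:
  assumes "coprime a b" "a > 0" "b > 0" "periodic_on V a F" "periodic_on V b G"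
  shows "(\<Sum>z\<in>cube V (a * b). F z * G z) = sum F (cube V a) * sum G (cube V b)"
proof -
  have "(\<Sum>z\<in>cube V (a * b). F z * G z) =
     (\<Sum>z\<in>cube V (a * b). F (\<lambda>v\<in>V. z v mod int a) * G (\<lambda>v\<in>V. z v mod int b))"
    by (intro sum.cong refl arg_cong2[of _ _ _ _ "(*)"] periodic_onD[OF assms(4)] periodic_onD[OF assms(5)]) auto
  also have "\<dots> = sum F (cube V a) * sum G (cube V b)"
    unfolding cube_def by (rule sum_PiE_bij_prod[OF bij_betw_mod_mod[OF assms(1-3)]])
  finally show ?thesis .
qed

lemma sum_cube_tile:
  assumes "finite V" "e > 0" "periodic_on V e F"
  shows "sum F (cube V (k * e)) = real k ^ card V * sum F (cube V e)"
proof -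
  have "sum F (cube V (k * e)) = (\<Sum>z\<in>cube V (k * e). F (\<lambda>v\<in>V. z v mod int e) * 1)"
    unfolding mult_1_right by (intro sum.cong refl periodic_onD[OF assms(3)]) auto
  also have "\<dots> = sum F (cube V e) * (\<Sum>z\<in>cube V k. 1)"
    unfolding cube_def by (rule sum_PiE_bij_prod[OF bij_betw_mod_div[OF assms(2)]])
  also have "(\<Sum>z\<in>cube V k. 1) = real k ^ card V" using assms by (simp add: card_cube)
  finally show ?thesis by simp
qed

text \<open>The Chinese remainder theorem as independence: functions of the residues modulo
  different primes average separately.\<close>

lemma sum_cube_prod_primes:
  assumes "finite V" "finite U" "\<And>p. p \<in> U \<Longrightarrow> prime p" "\<And>p. p \<in> U \<Longrightarrow> periodic_on V p (\<phi> p)"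
  shows "(\<Sum>z\<in>cube V (\<Prod>U). \<Prod>p\<in>U. \<phi> p z) = (\<Prod>p\<in>U. sum (\<phi> p) (cube V p))"
  using assms(2-)
proof (induction U rule: finite_induct)
  case empty
  show ?case using card_cube[OF assms(1), of 1] by simp
next
  case (insert p U)
  have "coprime p (\<Prod>U)"
    using insert by (intro prod_coprime_right) (auto intro!: primes_coprime)
  then have "(\<Sum>z\<in>cube V (p * \<Prod>U). \<phi> p z * (\<Prod>p\<in>U. \<phi> p z)) =
       sum (\<phi> p) (cube V p) * (\<Sum>z\<in>cube V (\<Prod>U). \<Prod>p\<in>U. \<phi> p z)"
    using insert by (intro sum_cube_mult_coprime periodic_on_prod) (auto simp: prime_gt_0_nat intro!: prod_pos)
  then show ?case using insert by simp
qed

text \<open>The cube is covered by whole periods, \<open>M div e + 1\<close> along each axis; since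
  \<open>e \<le> M\<close>, this is at most \<open>2 M / e\<close>.\<close>

lemma sum_cube_le:
  assumes "finite V" "0 < e" "e \<le> M" "periodic_on V e F" "\<And>z. F z \<ge> 0"
  shows "sum F (cube V M) \<le> (2 * real M / real e) ^ card V * sum F (cube V e)"
proof -
  let ?k = "M div e + 1"
  have mod: "M mod e < e" using assms by simp
  have le: "M \<le> ?k * e" using mod div_mult_mod_eq[of M e] by (simp only: add_mult_distrib mult_1)
  have "?k * e \<le> 2 * M" using \<open>e \<le> M\<close> div_times_less_eq_dividend[of M e] by (simp only: add_mult_distrib mult_1 mult_2)
  then have k: "real ?k \<le> 2 * real M / real e"
    using assms by (simp add: field_simps flip: of_nat_mult of_nat_add)
  have "sum F (cube V M) \<le> sum F (cube V (?k * e))"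
    using assms le by (intro sum_mono2 cube_mono finite_cube) auto
  also have "\<dots> = real ?k ^ card V * sum F (cube V e)"
    using assms by (intro sum_cube_tile)
  also have "\<dots> \<le> (2 * real M / real e) ^ card V * sum F (cube V e)"
    using k assms by (intro mult_right_mono power_mono sum_nonneg) auto
  finally show ?thesis .
qed

text \<open>Whole periods cancel. What remains is a boundary layer of thickness less than
  \<open>e\<close>, and Bernoulli's inequality bounds its share of the cube by
  \<open>card V * e / M\<close>.\<close>

lemma abs_sum_cube_le:
  assumes "finite V" "0 < e" "e \<le> M" "periodic_on V e F" "\<And>z. \<bar>F z\<bar> \<le> C"
    and "sum F (cube V e) = 0"
  shows "\<bar>sum F (cube V M)\<bar> \<le> real (card V) * real e / real M * real M ^ card V * C"
proof -
  let ?d = "card V"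
  let ?k = "M div e"
  have C: "C \<ge> 0" using assms(5)[of undefined] by linarith
  have M: "M > 0" using assms by simp
  have le: "?k * e \<le> M" by simp
  have mod: "M mod e < e" using assms by simp
  then have "M \<le> ?k * e + e" using div_mult_mod_eq[of M e] by linarith
  then have ge: "real M - real e \<le> real (?k * e)"
    by (simp only: of_nat_add[symmetric] of_nat_le_iff le_diff_eq diff_le_eq)
  have sub: "cube V (?k * e) \<subseteq> cube V M" by (intro cube_mono le)
  have fin: "finite (cube V M)" using assms by (simp add: finite_cube)
  have "sum F (cube V M) = sum F (cube V M - cube V (?k * e)) + sum F (cube V (?k * e))"
    using sub fin by (rule sum.subset_diff)
  also have "sum F (cube V (?k * e)) = 0"
    using assms by (subst sum_cube_tile) auto
  finally have "\<bar>sum F (cube V M)\<bar> \<le> (\<Sum>z\<in>cube V M - cube V (?k * e). \<bar>F z\<bar>)"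
    by (simp add: sum_abs)
  also have "\<dots> \<le> (\<Sum>z\<in>cube V M - cube V (?k * e). C)" by (intro sum_mono assms)
  also have "\<dots> = (real (card (cube V M)) - real (card (cube V (?k * e)))) * C"
    using sub fin finite_subset[OF sub fin]
    by (simp add: card_Diff_subset of_nat_diff card_mono del: of_nat_mult)
  also have "\<dots> = (real M ^ ?d - real (?k * e) ^ ?d) * C"
    using assms(1) by (simp add: card_cube)
  also have "\<dots> \<le> (real M ^ ?d * (real ?d * real e / real M)) * C"
  proof (intro mult_right_mono C)
    have "1 + real ?d * (- real e / real M) \<le> (1 + (- real e / real M)) ^ ?d"
      using assms M by (intro Bernoulli_inequality) (simp add: field_simps)
    then have "real M ^ ?d * (1 + real ?d * (- real e / real M)) \<le> real M ^ ?d * (1 + (- real e / real M)) ^ ?d"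
      by (intro mult_left_mono) auto
    also have "\<dots> = (real M - real e) ^ ?d"
      using M by (simp add: field_simps flip: power_mult_distrib)
    also have "\<dots> \<le> real (?k * e) ^ ?d" using ge assms by (intro power_mono) auto
    finally show "real M ^ ?d - real (?k * e) ^ ?d \<le> real M ^ ?d * (real ?d * real e / real M)"
      by (simp add: algebra_simps)
  qed
  finally show ?thesis by (simp add: mult_ac)
qed

subsection \<open>The sieve\<close>

text \<open>The centred indicator of divisibility, with the sign that makes it positive where
  \<open>p\<close> does not divide \<open>t\<close>.\<close>

definition residue_fluct :: "nat \<Rightarrow> int \<Rightarrow> real" where
  "residue_fluct p t = 1 / real p - of_bool (int p dvd t)"

lemma residue_fluct_cong: "int p dvd s - t \<Longrightarrow> residue_fluct p s = residue_fluct p t"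
  unfolding residue_fluct_def using dvd_add_right_iff[of "int p" "s - t" t] by simp

lemma residue_fluct_minus: "residue_fluct p (- t) = residue_fluct p t"
  by (simp add: residue_fluct_def)

lemma abs_residue_fluct_le: "p > 0 \<Longrightarrow> \<bar>residue_fluct p t\<bar> \<le> 1"
  by (auto simp: residue_fluct_def of_bool_def divide_le_eq field_simps)

lemma sum_of_bool_dvd:
  assumes "p > 0"
  shows "(\<Sum>t\<in>{0..<int p}. of_bool (int p dvd t - c) :: real) = 1"
proof -
  have "(int p dvd t - c) = (t = c mod int p)" if "t \<in> {0..<int p}" for t
    using that by (auto simp flip: mod_eq_dvd_iff)
  then have "(\<Sum>t\<in>{0..<int p}. of_bool (int p dvd t - c) :: real) =
     (\<Sum>t\<in>{0..<int p}. if t = c mod int p then 1 else 0)"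
    by (intro sum.cong) auto
  also have "\<dots> = 1" using assms by (subst sum.delta) auto
  finally show ?thesis .
qed

lemma sum_residue_fluct:
  assumes "p > 0"
  shows "(\<Sum>t\<in>{0..<int p}. residue_fluct p (t - c)) = 0"
  using sum_of_bool_dvd[OF assms] assms unfolding residue_fluct_def
  by (simp add: sum_subtractf)

lemma sum_residue_fluct':
  assumes "p > 0"
  shows "(\<Sum>t\<in>{0..<int p}. residue_fluct p (c - t)) = 0"
proof -
  have "residue_fluct p (c - t) = residue_fluct p (t - c)" for t
    using residue_fluct_minus[of p "t - c"] by simp
  then show ?thesis using sum_residue_fluct[OF assms, of c] by simp
qed

lemma sum_residue_fluct_square_le:
  assumes "p > 0"
  shows "(\<Sum>t\<in>{0..<int p}. residue_fluct p (t - c) ^ 2) \<le> 1"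
proof -
  have "(\<Sum>t\<in>{0..<int p}. residue_fluct p (t - c) ^ 2) =
     (\<Sum>t\<in>{0..<int p}. residue_fluct p (t - c) * (1 / real p) - residue_fluct p (t - c) * of_bool (int p dvd t - c))"
    by (intro sum.cong) (simp_all add: residue_fluct_def power2_eq_square algebra_simps)
  \<comment> \<open>The constant part drops out by the mean zero property, and only the one residue
    class divisible by \<open>p\<close> still contributes.\<close>
  also have "\<dots> = - (\<Sum>t\<in>{0..<int p}. residue_fluct p (t - c) * of_bool (int p dvd t - c))"
    using sum_residue_fluct[OF assms, of c] by (simp add: sum_subtractf flip: sum_divide_distrib)
  also have "\<dots> = (\<Sum>t\<in>{0..<int p}. (1 - 1 / real p) * of_bool (int p dvd t - c))"
    unfolding sum_negf[symmetric] by (intro sum.cong) (auto simp: residue_fluct_def of_bool_def)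
  also have "\<dots> = 1 - 1 / real p"
    using sum_of_bool_dvd[OF assms] by (simp flip: sum_distrib_left)
  finally show ?thesis by simp
qed

lemma sum_cube_residue_fluct:
  assumes "a \<noteq> b" "a \<in> V" "b \<in> V" "p > 0"
  shows "(\<Sum>z\<in>cube V p. residue_fluct p (z a - z b)) = 0"
  using assms by (subst sum_cube_coordinate[of a]) (auto simp: sum_residue_fluct)

lemma sum_cube_residue_fluct_square_le:
  assumes "finite V" "a \<noteq> b" "a \<in> V" "b \<in> V" "p > 0"
  shows "(\<Sum>z\<in>cube V p. residue_fluct p (z a - z b) ^ 2) \<le> real p ^ card V / real p"
proof -
  have "(\<Sum>z\<in>cube V p. residue_fluct p (z a - z b) ^ 2) \<le> (\<Sum>g\<in>cube (V - {a}) p. 1)"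
    using assms by (subst sum_cube_coordinate[of a]) (auto intro!: sum_mono sum_residue_fluct_square_le simp del: sum_constant)
  also have "\<dots> = real p ^ (card V - 1)"
    using assms by (simp add: card_cube)
  also have "\<dots> = real p ^ card V / real p"
  proof -
    have "card V > 0" using assms by (auto simp: card_gt_0_iff)
    then obtain n where "card V = Suc n" by (cases "card V") auto
    then show ?thesis using assms by simp
  qed
  finally show ?thesis .
qed

text \<open>Distinct edges of a bipartite graph are orthogonal because one of them has an endpoint
  that is not on the other.\<close>

lemma sum_cube_residue_fluct_mult:
  assumes "A \<inter> B = {}" "a \<in> A" "a' \<in> A" "b \<in> B" "b' \<in> B" "(a, b) \<noteq> (a', b')" "p > 0"
  shows "(\<Sum>z\<in>cube (A \<union> B) p. residue_fluct p (z a - z b) * residue_fluct p (z a' - z b')) = 0"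
proof (cases "a = a'")
  case False
  then have "a \<noteq> b" "a \<noteq> b'" "a' \<noteq> a" using assms by auto
  then show ?thesis
    using assms by (subst sum_cube_coordinate[of a])
      (auto simp: sum_residue_fluct simp flip: sum_distrib_right)
next
  case True
  then have "b \<noteq> b'" "b \<noteq> a" "b \<noteq> a'" using assms by auto
  then show ?thesis
    using assms by (subst sum_cube_coordinate[of b])
      (auto simp: sum_residue_fluct' simp flip: sum_distrib_right)
qed

text \<open>\<open>A\<close> and \<open>B\<close> are the two sides of a complete bipartite graph,
  and a pair \<open>(a, b)\<close> is an edge. Edges are added rather than multiplied so that only
  pairs of them interact in the second moment.\<close>

definition edge_fluct :: "'v set \<Rightarrow> 'v set \<Rightarrow> nat \<Rightarrow> ('v \<Rightarrow> int) \<Rightarrow> real" where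
  "edge_fluct A B p z = (\<Sum>(a, b)\<in>A \<times> B. residue_fluct p (z a - z b))"

lemma periodic_on_edge_fluct: "periodic_on (A \<union> B) p (edge_fluct A B p)"
  unfolding periodic_on_def edge_fluct_def
proof (intro allI impI sum.cong refl)
  fix z z' :: "'a \<Rightarrow> int" and e
  assume *: "\<forall>v\<in>A \<union> B. int p dvd z v - z' v" and e: "e \<in> A \<times> B"
  obtain a b where [simp]: "e = (a, b)" by (cases e)
  have "int p dvd (z a - z' a) - (z b - z' b)" using * e by (metis SigmaE UnCI dvd_diff prod.inject \<open>e = (a, b)\<close>)
  then have "int p dvd (z a - z b) - (z' a - z' b)" by (simp add: algebra_simps)
  then show "(case e of (a, b) \<Rightarrow> residue_fluct p (z a - z b)) = (case e of (a, b) \<Rightarrow> residue_fluct p (z' a - z' b))"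
    by (auto intro: residue_fluct_cong)
qed

lemma abs_edge_fluct_le:
  assumes "p > 0"
  shows "\<bar>edge_fluct A B p z\<bar> \<le> real (card A * card B)"
proof -
  have "\<bar>edge_fluct A B p z\<bar> \<le> (\<Sum>e\<in>A \<times> B. 1)"
    unfolding edge_fluct_def using abs_residue_fluct_le[OF assms]
    by (intro order.trans[OF sum_abs] sum_mono) auto
  then show ?thesis by (simp add: card_cartesian_product)
qed

lemma edge_fluct_sifted:
  assumes "\<And>a b. a \<in> A \<Longrightarrow> b \<in> B \<Longrightarrow> \<not> int p dvd z a - z b"
  shows "edge_fluct A B p z = real (card A * card B) / real p"
proof -
  have "edge_fluct A B p z = (\<Sum>e\<in>A \<times> B. 1 / real p)"
    unfolding edge_fluct_def using assms by (intro sum.cong) (auto simp: residue_fluct_def)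
  then show ?thesis by (simp add: card_cartesian_product)
qed

lemma sum_cube_edge_fluct:
  assumes "A \<inter> B = {}" "p > 0"
  shows "(\<Sum>z\<in>cube (A \<union> B) p. edge_fluct A B p z) = 0"
  unfolding edge_fluct_def using assms
  by (subst sum.swap) (rule sum.neutral, auto intro!: sum_cube_residue_fluct)

text \<open>Distinct edges are orthogonal, so only the \<open>card A * card B\<close> diagonal terms
  survive, each with mean at most \<open>1 / p\<close>.\<close>

lemma sum_cube_edge_fluct_square_le:
  assumes "finite A" "finite B" "A \<inter> B = {}" "p > 0"
  shows "(\<Sum>z\<in>cube (A \<union> B) p. edge_fluct A B p z ^ 2)
           \<le> real p ^ card (A \<union> B) * (real (card A * card B) / real p)"
proof -
  let ?V = "A \<union> B"
  let ?\<psi> = "\<lambda>z (a, b). residue_fluct p (z a - z b)"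
  have "(\<Sum>z\<in>cube ?V p. edge_fluct A B p z ^ 2) =
     (\<Sum>z\<in>cube ?V p. \<Sum>e\<in>A \<times> B. \<Sum>e'\<in>A \<times> B. ?\<psi> z e * ?\<psi> z e')"
    unfolding edge_fluct_def by (simp add: power2_eq_square sum_product)
  also have "\<dots> = (\<Sum>e\<in>A \<times> B. \<Sum>z\<in>cube ?V p. \<Sum>e'\<in>A \<times> B. ?\<psi> z e * ?\<psi> z e')"
    by (rule sum.swap)
  also have "\<dots> = (\<Sum>e\<in>A \<times> B. \<Sum>e'\<in>A \<times> B. \<Sum>z\<in>cube ?V p. ?\<psi> z e * ?\<psi> z e')"
    by (intro sum.cong refl sum.swap)
  also have "\<dots> \<le> (\<Sum>e\<in>A \<times> B. \<Sum>e'\<in>A \<times> B. if e' = e then real p ^ card ?V / real p else 0)"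
  proof (intro sum_mono)
    fix e e' assume e: "e \<in> A \<times> B" "e' \<in> A \<times> B"
    obtain a b a' b' where [simp]: "e = (a, b)" "e' = (a', b')" by (cases e, cases e')
    show "(\<Sum>z\<in>cube ?V p. ?\<psi> z e * ?\<psi> z e') \<le> (if e' = e then real p ^ card ?V / real p else 0)"
    proof (cases "e' = e")
      case True
      have "(\<Sum>z\<in>cube ?V p. residue_fluct p (z a - z b) ^ 2) \<le> real p ^ card ?V / real p"
        using e assms by (intro sum_cube_residue_fluct_square_le) auto
      then show ?thesis using True by (simp add: power2_eq_square)
    next
      case False
      then show ?thesis
        using e sum_cube_residue_fluct_mult[of A B a a' b b' p] assms by auto
    qed
  qed
  also have "\<dots> = (\<Sum>e\<in>A \<times> B. real p ^ card ?V / real p)"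
    using assms by (intro sum.cong refl) (simp add: sum.delta)
  finally show ?thesis by (simp add: card_cartesian_product mult_ac)
qed

section \<open>Orthogonality over squarefree moduli and the sieve bound\<close>

lemma finite_sieve_support: "finite (sieve_support \<kappa> z Q)"
proof -
  have "finite {p. prime p \<and> \<kappa> \<le> p \<and> p \<le> z}" by (rule finite_subset[of _ "{..z}"]) auto
  then show ?thesis
    by (rule finite_subset[rotated, OF finite_Pow_iff[THEN iffD2]]) (auto simp: sieve_support_def)
qed

lemma sieve_supportD:
  assumes "S \<in> sieve_support \<kappa> z Q"
  shows "finite S" "\<And>p. p \<in> S \<Longrightarrow> prime p" "\<And>p. p \<in> S \<Longrightarrow> \<kappa> \<le> p" "\<And>p. p \<in> S \<Longrightarrow> p \<le> z"
    "\<Prod>S \<le> Q" "\<Prod>S > 0"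
proof -
  show "finite S" using assms by (auto simp: sieve_support_def intro: finite_subset[of _ "{..z}"])
  show "\<Prod>S > 0" using assms by (intro prod_pos) (auto simp: sieve_support_def prime_gt_0_nat)
qed (use assms in \<open>auto simp: sieve_support_def\<close>)

text \<open>By unique factorization the moduli are distinct integers in \<open>{1..Q}\<close>. This
  limits the number of off-diagonal pairs in the second moment.\<close>

lemma card_sieve_support_le: "card (sieve_support \<kappa> z Q) \<le> Q"
proof -
  let ?P = "{p. prime p \<and> \<kappa> \<le> p \<and> p \<le> z}"
  have fin: "finite ?P" by (rule finite_subset[of _ "{..z}"]) auto
  have "card (sieve_support \<kappa> z Q) = card ((\<lambda>S. \<Prod>S) ` sieve_support \<kappa> z Q)"
    by (intro card_image[symmetric] inj_on_subset[OF inj_on_prod_primes[OF fin]])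
      (auto simp: sieve_support_def)
  also have "\<dots> \<le> card {1..Q}"
    using sieve_supportD(5,6)[of _ \<kappa> z Q] by (intro card_mono) (auto simp: Suc_le_eq)
  finally show ?thesis by simp
qed

text \<open>A prime in exactly one of \<open>S\<close> and \<open>T\<close> enters to the first
  power, and its factor in the product over primes is a vanishing mean.\<close>

lemma sum_cube_edge_fluct_orthogonal:
  assumes "finite A" "finite B" "A \<inter> B = {}" "finite S" "finite T" "S \<noteq> T"
    and "\<And>p. p \<in> S \<union> T \<Longrightarrow> prime p"
  shows "(\<Sum>z\<in>cube (A \<union> B) (\<Prod>(S \<union> T)).
            (\<Prod>p\<in>S. edge_fluct A B p z) * (\<Prod>p\<in>T. edge_fluct A B p z)) = 0"
proof -
  let ?U = "S \<union> T"
  let ?f = "edge_fluct A B"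
  define \<phi> where "\<phi> p z = (if p \<in> S then ?f p z else 1) * (if p \<in> T then ?f p z else 1)" for p z
  have res: "(\<Prod>p\<in>R. g p) = (\<Prod>p\<in>?U. if p \<in> R then g p else 1)" if "R \<subseteq> ?U" for R and g :: "nat \<Rightarrow> real"
    using that prod.inter_restrict[of ?U g R] assms by (simp add: Int_absorb1)
  have "(\<Prod>p\<in>S. ?f p z) * (\<Prod>p\<in>T. ?f p z) = (\<Prod>p\<in>?U. \<phi> p z)" for z
    unfolding \<phi>_def prod.distrib by (simp flip: res)
  moreover have "periodic_on (A \<union> B) p (\<phi> p)" for p
    unfolding \<phi>_def by (intro periodic_on_mult; cases "p \<in> S"; cases "p \<in> T")
      (simp_all add: periodic_on_edge_fluct)
  ultimately have "(\<Sum>z\<in>cube (A \<union> B) (\<Prod>?U). (\<Prod>p\<in>S. ?f p z) * (\<Prod>p\<in>T. ?f p z)) =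
      (\<Prod>p\<in>?U. sum (\<phi> p) (cube (A \<union> B) p))"
    using assms sum_cube_prod_primes[of "A \<union> B" ?U \<phi>] by simp
  also have "\<dots> = 0"
  proof -
    obtain p where p: "p \<in> ?U" "p \<notin> S \<or> p \<notin> T" using assms(6) by blast
    then have "\<phi> p = ?f p" unfolding \<phi>_def by auto
    moreover have "p > 0" using assms(7)[OF p(1)] by (rule prime_gt_0_nat)
    ultimately have "sum (\<phi> p) (cube (A \<union> B) p) = 0" using assms by (simp add: sum_cube_edge_fluct)
    then show ?thesis using p(1) assms(4,5) by (auto simp: prod_zero_iff)
  qed
  finally show ?thesis .
qed

lemma sum_cube_edge_fluct_prod_square_le:
  assumes "finite A" "finite B" "A \<inter> B = {}" "finite S" "\<And>p. p \<in> S \<Longrightarrow> prime p"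
  shows "(\<Sum>z\<in>cube (A \<union> B) (\<Prod>S). (\<Prod>p\<in>S. edge_fluct A B p z) ^ 2)
           \<le> real (\<Prod>S) ^ card (A \<union> B) * sieve_density (card A * card B) S"
proof -
  let ?V = "A \<union> B" and ?f = "edge_fluct A B"
  have "(\<Sum>z\<in>cube ?V (\<Prod>S). (\<Prod>p\<in>S. ?f p z) ^ 2) = (\<Sum>z\<in>cube ?V (\<Prod>S). \<Prod>p\<in>S. ?f p z ^ 2)"
    by (simp add: prod_power_distrib)
  also have "\<dots> = (\<Prod>p\<in>S. \<Sum>z\<in>cube ?V p. ?f p z ^ 2)"
    using assms by (intro sum_cube_prod_primes)
      (auto simp: power2_eq_square intro!: periodic_on_mult periodic_on_edge_fluct)
  also have "\<dots> \<le> (\<Prod>p\<in>S. real p ^ card ?V * (real (card A * card B) / real p))"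
    using assms by (intro prod_mono conjI sum_nonneg sum_cube_edge_fluct_square_le) (auto simp: prime_gt_0_nat)
  also have "\<dots> = real (\<Prod>S) ^ card ?V * sieve_density (card A * card B) S"
    by (simp only: sieve_density_def prod.distrib prod_power_distrib of_nat_prod)
  finally show ?thesis .
qed

text \<open>A Selberg-type sieve. The weight \<open>h\<close> equals \<open>L\<close> on sifted points, and its summands are almost
  orthogonal with variances adding up to at most \<open>L\<close>, so Chebyshev's inequality applies.\<close>

lemma card_sifted_le:
  fixes A B :: "'v set"
  assumes fin: "finite A" "finite B" and disj: "A \<inter> B = {}"
    and \<kappa>: "\<kappa> = card A * card B" "\<kappa> \<ge> 1" and Q: "Q \<ge> 1" "Q ^ 6 \<le> M"
  shows "real (card {w\<in>cube (A \<union> B) M. \<forall>p. prime p \<and> \<kappa> \<le> p \<and> p \<le> z \<longrightarrow>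
                        (\<forall>a\<in>A. \<forall>b\<in>B. \<not> int p dvd w a - w b)})
           * (\<Sum>S\<in>sieve_support \<kappa> z Q. sieve_density \<kappa> S)
         \<le> (2 ^ card (A \<union> B) + real (card (A \<union> B))) * real M ^ card (A \<union> B)"
    (is "real (card ?Sif) * _ \<le> _")
proof -
  let ?V = "A \<union> B"
  let ?d = "card ?V"
  let ?D = "sieve_support \<kappa> z Q"
  define L where "L = (\<Sum>S\<in>?D. sieve_density \<kappa> S)"
  define f where "f S w = (\<Prod>p\<in>S. edge_fluct A B p w)" for S w
  define h where "h w = (\<Sum>S\<in>?D. f S w)" for w
  have finV: "finite ?V" and finD: "finite ?D" using fin by (auto simp: finite_sieve_support)
  have dens: "sieve_density \<kappa> S \<ge> 0" for S unfolding sieve_density_def by (intro prod_nonneg) auto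
  \<comment> \<open>The empty set, the modulus 1, contributes 1. Hence \<open>L \<ge> 1\<close>,
    which later absorbs the error term into a multiple of \<open>L\<close> and allows division by
    \<open>L\<close>.\<close>
  have "{} \<in> ?D" using Q by (simp add: sieve_support_def)
  then have L1: "L \<ge> 1"
    unfolding L_def using finD dens member_le_sum[of "{}" ?D "sieve_density \<kappa>"]
    by (simp add: sieve_density_def)
  have M: "M > 0" using Q by (metis le_zero_eq not_gr0 not_one_le_zero one_le_power order_trans)
  have QM: "Q ^ n \<le> M" if "n \<le> 6" for n
    using Q that by (meson le_trans power_increasing)
  have absf: "\<bar>f S w\<bar> \<le> real Q" if "S \<in> ?D" for S w
  proof -
    have "\<bar>f S w\<bar> \<le> (\<Prod>p\<in>S. real p)"
      unfolding f_def abs_prod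
    proof (intro prod_mono conjI)
      fix p assume p: "p \<in> S"
      have "\<bar>edge_fluct A B p w\<bar> \<le> real \<kappa>"
        unfolding \<kappa> using sieve_supportD(2)[OF that p] by (intro abs_edge_fluct_le prime_gt_0_nat)
      then show "\<bar>edge_fluct A B p w\<bar> \<le> real p" using sieve_supportD(3)[OF that p] by linarith
    qed auto
    also have "\<dots> = real (\<Prod>S)" by simp
    also have "\<dots> \<le> real Q" using sieve_supportD(5)[OF that] by (simp only: of_nat_le_iff)
    finally show ?thesis .
  qed
  have per: "periodic_on ?V (\<Prod>S) (f S)" if "S \<in> ?D" for S
    unfolding f_def using sieve_supportD(1)[OF that] by (intro periodic_on_prod periodic_on_edge_fluct)
  have diag: "(\<Sum>w\<in>cube ?V M. f S w * f S w) \<le> (2 * real M) ^ ?d * sieve_density \<kappa> S" if S: "S \<in> ?D" for S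
  proof -
    let ?e = "\<Prod>S"
    have e: "0 < ?e" "?e \<le> M" using sieve_supportD(5,6)[OF S] QM[of 1] by auto
    have "(\<Sum>w\<in>cube ?V M. f S w * f S w) \<le> (2 * real M / real ?e) ^ ?d * (\<Sum>w\<in>cube ?V ?e. f S w * f S w)"
      using e per[OF S] finV by (intro sum_cube_le periodic_on_mult) auto
    moreover have "(\<Sum>w\<in>cube ?V ?e. f S w * f S w) \<le> real ?e ^ ?d * sieve_density \<kappa> S"
      using sum_cube_edge_fluct_prod_square_le[OF fin disj sieve_supportD(1,2)[OF S]]
      by (simp add: f_def power2_eq_square \<kappa>)
    then have "(2 * real M / real ?e) ^ ?d * (\<Sum>w\<in>cube ?V ?e. f S w * f S w) \<le>
        (2 * real M / real ?e) ^ ?d * (real ?e ^ ?d * sieve_density \<kappa> S)"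
      by (intro mult_left_mono) (auto simp del: of_nat_prod)
    ultimately have "(\<Sum>w\<in>cube ?V M. f S w * f S w) \<le>
        (2 * real M / real ?e) ^ ?d * (real ?e ^ ?d * sieve_density \<kappa> S)"
      by linarith
    also have "\<dots> = (2 * real M) ^ ?d * sieve_density \<kappa> S"
      using e by (simp add: power_divide del: of_nat_prod)
    finally show ?thesis .
  qed
  have off: "(\<Sum>w\<in>cube ?V M. f S w * f T w) \<le> real ?d * real Q ^ 4 / real M * real M ^ ?d"
    if S: "S \<in> ?D" and T: "T \<in> ?D" and "S \<noteq> T" for S T
  proof -
    let ?e = "\<Prod>(S \<union> T)"
    note DS = sieve_supportD[OF S] and DT = sieve_supportD[OF T]
    have "?e * \<Prod>(S \<inter> T) = \<Prod>S * \<Prod>T" using DS(1) DT(1) by (rule prod.union_inter)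
    moreover have "\<Prod>(S \<inter> T) > 0" using DS(2) by (intro prod_pos) (auto simp: prime_gt_0_nat)
    ultimately have "?e \<le> \<Prod>S * \<Prod>T" by (metis Suc_leI mult.right_neutral mult_le_mono2 One_nat_def)
    also have "\<dots> \<le> Q * Q" using DS(5) DT(5) by (rule mult_le_mono)
    finally have e2: "?e \<le> Q ^ 2" by (simp add: power2_eq_square)
    have e0: "?e > 0" using DS(2) DT(2) by (intro prod_pos) (auto simp: prime_gt_0_nat)
    have eM: "?e \<le> M" using e2 QM[of 2] by simp
    have dvd: "\<Prod>S dvd ?e" "\<Prod>T dvd ?e" using DS(1) DT(1) by (auto intro!: prod_dvd_prod_subset)
    have "\<bar>\<Sum>w\<in>cube ?V M. f S w * f T w\<bar> \<le> real ?d * real ?e / real M * real M ^ ?d * (real Q * real Q)"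
    proof (rule abs_sum_cube_le[OF finV e0 eM])
      show "periodic_on ?V ?e (\<lambda>w. f S w * f T w)"
        using per[OF S] per[OF T] dvd by (intro periodic_on_mult) (auto intro: periodic_on_dvd)
      show "\<bar>f S w * f T w\<bar> \<le> real Q * real Q" for w
        unfolding abs_mult using absf[OF S] absf[OF T] by (intro mult_mono) auto
      show "(\<Sum>w\<in>cube ?V ?e. f S w * f T w) = 0"
        unfolding f_def using DS(1,2) DT(1,2) that(3)
        by (intro sum_cube_edge_fluct_orthogonal[OF fin disj]) auto
    qed
    also have "\<dots> \<le> real ?d * real (Q ^ 2) / real M * real M ^ ?d * (real Q * real Q)"
      using e2 by (intro mult_right_mono divide_right_mono mult_left_mono) (auto simp del: of_nat_power of_nat_prod)
    also have "\<dots> = real ?d * real Q ^ 4 / real M * real M ^ ?d" by (simp add: power2_eq_square power4_eq_xxxx)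
    finally show ?thesis by linarith
  qed
  \<comment> \<open>Half of \<open>Q ^ 4\<close> is the period, at most \<open>Q ^ 2\<close>, and
    half the size of the product. With at most \<open>Q ^ 2\<close> pairs \<open>(S, T)\<close> the
    total is of order \<open>Q ^ 6 / M\<close>, whence the hypothesis
    \<open>Q ^ 6 \<le> M\<close>.\<close>
  define E where "E = real ?d * real Q ^ 4 / real M * real M ^ ?d"
  have E0: "E \<ge> 0" by (simp add: E_def)
  have "real (card ?Sif) * L ^ 2 = (\<Sum>w\<in>?Sif. h w ^ 2)"
  proof -
    have "h w = L" if "w \<in> ?Sif" for w
    proof -
      have "edge_fluct A B p w = real \<kappa> / real p" if "p \<in> S" "S \<in> ?D" for p S
        unfolding \<kappa> using \<open>w \<in> ?Sif\<close> sieve_supportD(2-4)[OF that(2,1)] by (intro edge_fluct_sifted) auto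
      then show ?thesis unfolding h_def L_def f_def sieve_density_def
        by (intro sum.cong prod.cong refl) auto
    qed
    then show ?thesis by simp
  qed
  also have "\<dots> \<le> (\<Sum>w\<in>cube ?V M. h w ^ 2)"
    using finV by (intro sum_mono2 finite_cube) auto
  also have "\<dots> = (\<Sum>w\<in>cube ?V M. \<Sum>S\<in>?D. \<Sum>T\<in>?D. f S w * f T w)"
    unfolding h_def by (simp add: power2_eq_square sum_product)
  also have "\<dots> = (\<Sum>S\<in>?D. \<Sum>w\<in>cube ?V M. \<Sum>T\<in>?D. f S w * f T w)"
    by (rule sum.swap)
  also have "\<dots> = (\<Sum>S\<in>?D. \<Sum>T\<in>?D. \<Sum>w\<in>cube ?V M. f S w * f T w)"
    by (intro sum.cong refl sum.swap)
  also have "\<dots> \<le> (\<Sum>S\<in>?D. \<Sum>T\<in>?D. (if T = S then (2 * real M) ^ ?d * sieve_density \<kappa> S else 0) + E)"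
  proof (intro sum_mono)
    fix S T assume "S \<in> ?D" "T \<in> ?D"
    then show "(\<Sum>w\<in>cube ?V M. f S w * f T w) \<le> (if T = S then (2 * real M) ^ ?d * sieve_density \<kappa> S else 0) + E"
      using diag[of S] off[of S T, folded E_def] E0 by (cases "T = S") auto
  qed
  also have "\<dots> = (2 * real M) ^ ?d * L + real (card ?D) * (real (card ?D) * E)"
    using finD by (simp add: sum.distrib sum.delta L_def sum_distrib_left)
  also have "real (card ?D) * (real (card ?D) * E) \<le> real Q * (real Q * E)"
    using card_sieve_support_le[of \<kappa> z Q] E0 by (intro mult_mono) auto
  also have "\<dots> = real ?d * real M ^ ?d * (real Q ^ 6 / real M)"
    by (simp add: E_def eval_nat_numeral)
  also have "\<dots> \<le> real ?d * real M ^ ?d * 1"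
    using Q(2) M by (intro mult_left_mono) (auto simp flip: of_nat_power)
  also have "\<dots> \<le> real ?d * real M ^ ?d * L" using L1 by (intro mult_left_mono) auto
  also have "(2 * real M) ^ ?d * L + real ?d * real M ^ ?d * L = (2 ^ ?d + real ?d) * real M ^ ?d * L"
    by (simp add: power_mult_distrib algebra_simps)
  finally have "real (card ?Sif) * L * L \<le> (2 ^ ?d + real ?d) * real M ^ ?d * L"
    by (simp add: power2_eq_square mult.assoc)
  then show ?thesis using L1 unfolding L_def[symmetric] by (simp add: mult_le_cancel_right)
qed

section \<open>Counting configurations of prime differences\<close>

lemma card_cube_close_le:
  assumes "finite V" "a \<in> V" "b \<in> V" "a \<noteq> b" "M > 0"
  shows "real (card {w\<in>cube V M. 0 < w a - w b \<and> w a - w b \<le> int Q}) \<le> real Q * real M ^ card V / real M"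
proof -
  have "real (card {w\<in>cube V M. 0 < w a - w b \<and> w a - w b \<le> int Q}) =
      (\<Sum>w\<in>cube V M. of_bool (0 < w a - w b \<and> w a - w b \<le> int Q))"
    using assms by (subst sum_of_bool_eq) (auto simp: finite_cube Int_def)
  also have "\<dots> = (\<Sum>g\<in>cube (V - {a}) M. \<Sum>t\<in>{0..<int M}. of_bool (0 < t - g b \<and> t - g b \<le> int Q))"
    using assms by (subst sum_cube_coordinate[of a]) auto
  also have "\<dots> \<le> (\<Sum>g\<in>cube (V - {a}) M. real Q)"
  proof (rule sum_mono)
    fix g
    have "(\<Sum>t\<in>{0..<int M}. of_bool (0 < t - g b \<and> t - g b \<le> int Q)) =
        real (card ({0..<int M} \<inter> {t. 0 < t - g b \<and> t - g b \<le> int Q}))"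
      by (subst sum_of_bool_eq) auto
    also have "\<dots> \<le> real (card {g b<..g b + int Q})"
      by (intro of_nat_mono card_mono) auto
    finally show "(\<Sum>t\<in>{0..<int M}. of_bool (0 < t - g b \<and> t - g b \<le> int Q)) \<le> real Q" by simp
  qed
  also have "\<dots> = real Q * real M ^ (card V - 1)"
    using assms by (simp add: card_cube)
  also have "\<dots> = real Q * real M ^ card V / real M"
  proof -
    have "card V > 0" using assms by (auto simp: card_gt_0_iff)
    then obtain n where "card V = Suc n" by (cases "card V") auto
    then show ?thesis using assms by simp
  qed
  finally show ?thesis .
qed

lemma exists_nat_root:
  fixes M n :: nat
  assumes "M \<ge> 2 ^ n" "n > 0"
  obtains z where "z \<ge> 2" "z ^ n \<le> M" "M < (z + 1) ^ n"
proof -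
  define k where "k = (LEAST k. M < k ^ n)"
  have "M < (M + 1) ^ n" using assms(2) by (metis less_add_one less_le_trans self_le_power le_add2)
  then have k: "M < k ^ n" unfolding k_def by (rule LeastI)
  have "\<not> k \<le> 2" using k assms(1) power_mono[of k 2 n] by auto
  moreover have "\<not> M < (k - 1) ^ n"
    using calculation not_less_Least[of "k - 1" "\<lambda>k. M < k ^ n"] by (auto simp: k_def)
  ultimately show ?thesis using k that[of "k - 1"] by auto
qed

text \<open>A prime difference above \<open>Q \<ge> z\<close> has no prime factor up to
  \<open>z\<close>, so the configuration is sifted. A prime difference of at most \<open>Q\<close>
  may escape the sieve, but \<open>card_cube_close_le\<close> shows that such configurations are
  rare.\<close>

lemma card_prime_differences_le:
  fixes A B :: "'v set"
  assumes fin: "finite A" "finite B" and disj: "A \<inter> B = {}" and ne: "A \<noteq> {}" "B \<noteq> {}"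
  obtains C where "C > 0"
    "\<And>M. M \<ge> 2 \<Longrightarrow> real (card {w\<in>cube (A \<union> B) M. \<forall>a\<in>A. \<forall>b\<in>B. prime (nat (w a - w b))})
        \<le> C * real M ^ card (A \<union> B) / ln (real M) ^ (card A * card B)"
proof -
  let ?V = "A \<union> B"
  define d where "d = card ?V"
  define \<kappa> where "\<kappa> = card A * card B"
  have \<kappa>1: "\<kappa> \<ge> 1" using fin ne by (simp add: \<kappa>_def Suc_le_eq card_gt_0_iff)
  have finV: "finite ?V" using fin by simp
  define u where "u = 4 * \<kappa> + 1"
  define K where "K = 2 ^ d + real d"
  define c where "c = exp (- 3 * real \<kappa> ^ 2) / 2 / 2 ^ \<kappa>"
  have c: "c > 0" by (simp add: c_def)
  have K: "K > 0" by (simp add: K_def add_pos_nonneg)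
  define C1 where "C1 = (K / c + real \<kappa>) * (12 * real u) ^ \<kappa>"
  \<comment> \<open>\<open>C2\<close> serves the range \<open>M < 2 ^ (6 * u)\<close>, which has no
    admissible \<open>z \<ge> 2\<close>; there \<open>ln M\<close> is bounded and the trivial count
    \<open>M ^ d\<close> suffices.\<close>
  define C2 where "C2 = (ln (2 ^ (6 * u)) :: real) ^ \<kappa>"
  have C1: "C1 > 0" using c K by (auto simp: C1_def u_def intro!: mult_pos_pos add_pos_nonneg)
  have C2: "C2 \<ge> 0" by (simp add: C2_def)
  have main: "real (card {w\<in>cube ?V M. \<forall>a\<in>A. \<forall>b\<in>B. prime (nat (w a - w b))})
        \<le> (C1 + C2) * real M ^ d / ln (real M) ^ \<kappa>" (is "real (card ?P) \<le> _") if M: "M \<ge> 2" for M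
  proof (cases "M < 2 ^ (6 * u)")
    case True
    have lnM: "ln (real M) > 0" using M by simp
    have "real M \<le> real (2 ^ (6 * u))" using True by (intro of_nat_mono) simp
    then have "ln (real M) \<le> ln (2 ^ (6 * u))" using M by (subst ln_le_cancel_iff) auto
    then have "ln (real M) ^ \<kappa> \<le> C2" unfolding C2_def using lnM by (intro power_mono) auto
    then have le: "ln (real M) ^ \<kappa> \<le> C1 + C2" using C1 by linarith
    have "card ?P \<le> card (cube ?V M)" using finV by (intro card_mono finite_cube) auto
    then have "real (card ?P) \<le> real M ^ d" using finV by (simp add: card_cube d_def flip: of_nat_power)
    also have "\<dots> = ln (real M) ^ \<kappa> * real M ^ d / ln (real M) ^ \<kappa>" using lnM by simp
    also have "\<dots> \<le> (C1 + C2) * real M ^ d / ln (real M) ^ \<kappa>"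
      using le lnM by (intro divide_right_mono mult_right_mono) auto
    finally show ?thesis .
  next
    case False
    \<comment> \<open>Two demands fix the exponent: the truncation level must be
      \<open>z ^ u\<close> for the density sum to be large, and its sixth power must not exceed
      \<open>M\<close>.\<close>
    then obtain z where z: "z \<ge> 2" "z ^ (6 * u) \<le> M" "M < (z + 1) ^ (6 * u)"
      using exists_nat_root[of "6 * u" M] by (auto simp: u_def)
    define Q where "Q = z ^ u"
    have Q1: "Q \<ge> 1" using z by (simp add: Q_def)
    have Q6: "Q ^ 6 \<le> M" using z(2) by (simp add: Q_def mult.commute flip: power_mult)
    have zQ: "z \<le> Q" using z(1) by (simp add: Q_def u_def self_le_power)
    have lnz: "ln (real z) > 0" using z by simp
    have lnM: "ln (real M) > 0" using M by simp
    have ln_le: "ln (real M) \<le> 12 * real u * ln (real z)"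
    proof -
      \<comment> \<open>Replacing \<open>z + 1\<close> by \<open>z ^ 2\<close> doubles the exponent,
        so 12 appears instead of 6.\<close>
      have "2 * z \<le> z * z" using z(1) by (rule mult_le_mono1)
      then have "z + 1 \<le> z ^ 2" using z(1) unfolding power2_eq_square by linarith
      then have "(z + 1) ^ (6 * u) \<le> (z ^ 2) ^ (6 * u)" by (intro power_mono) auto
      then have "M \<le> z ^ (12 * u)" using z(3) by (simp flip: power_mult)
      then have "real M \<le> real z ^ (12 * u)" by (simp flip: of_nat_power)
      then have "ln (real M) \<le> ln (real z ^ (12 * u))" using M z by (subst ln_le_cancel_iff) auto
      also have "\<dots> = 12 * real u * ln (real z)" using z by (simp add: ln_realpow)
      finally show ?thesis .
    qed
    let ?Sif = "{w\<in>cube ?V M. \<forall>p. prime p \<and> \<kappa> \<le> p \<and> p \<le> z \<longrightarrow> (\<forall>a\<in>A. \<forall>b\<in>B. \<not> int p dvd w a - w b)}"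
    let ?N = "\<lambda>(a, b). {w\<in>cube ?V M. 0 < w a - w b \<and> w a - w b \<le> int Q}"
    have sub: "?P \<subseteq> ?Sif \<union> (\<Union>e\<in>A \<times> B. ?N e)"
    proof
      fix w assume w: "w \<in> ?P"
      show "w \<in> ?Sif \<union> (\<Union>e\<in>A \<times> B. ?N e)"
      proof (cases "\<exists>a\<in>A. \<exists>b\<in>B. w a - w b \<le> int Q")
        case True
        then obtain a b where ab: "a \<in> A" "b \<in> B" "w a - w b \<le> int Q" by blast
        moreover have "prime (nat (w a - w b))" using w ab by blast
        then have "0 < w a - w b" using prime_gt_0_nat[of "nat (w a - w b)"] by simp
        ultimately show ?thesis using w by (intro UnI2 UN_I[of "(a, b)"]) auto
      next
        case False
        have "\<not> int p dvd w a - w b" if "prime p" "p \<le> z" "a \<in> A" "b \<in> B" for p a b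
        proof
          assume dvd: "int p dvd w a - w b"
          have Qlt: "int Q < w a - w b" using False that by force
          then have "p dvd nat (w a - w b)" using dvd by (simp add: nat_dvd_iff int_dvd_int_iff[symmetric])
          moreover have "prime (nat (w a - w b))" using w that by blast
          ultimately have "p = nat (w a - w b)" using that primes_dvd_imp_eq by blast
          then show False using Qlt zQ that by linarith
        qed
        then show ?thesis using w by auto
      qed
    qed
    have N: "real (card (?N e)) \<le> real Q * real M ^ d / real M" if e: "e \<in> A \<times> B" for e
    proof -
      obtain a b where ab: "e = (a, b)" "a \<in> A" "b \<in> B" using e by auto
      then have "a \<noteq> b" using disj by auto
      then show ?thesis using ab M card_cube_close_le[OF finV, of a b M Q] by (simp add: d_def)
    qed
    have "card ?P \<le> card (?Sif \<union> (\<Union>e\<in>A \<times> B. ?N e))"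
      using finite_cube[OF finV, of M] fin by (intro card_mono sub) auto
    also have "\<dots> \<le> card ?Sif + card (\<Union>e\<in>A \<times> B. ?N e)" by (rule card_Un_le)
    also have "card (\<Union>e\<in>A \<times> B. ?N e) \<le> (\<Sum>e\<in>A \<times> B. card (?N e))"
      using fin by (intro card_UN_le) auto
    finally have "real (card ?P) \<le> real (card ?Sif) + (\<Sum>e\<in>A \<times> B. real (card (?N e)))"
      by (simp only: of_nat_add[symmetric] of_nat_sum[symmetric] of_nat_le_iff)
    also have "(\<Sum>e\<in>A \<times> B. real (card (?N e))) \<le> (\<Sum>e\<in>A \<times> B. real Q * real M ^ d / real M)"
      by (intro sum_mono N)
    also have "\<dots> = real \<kappa> * (real Q * real M ^ d / real M)" by (simp add: card_cartesian_product \<kappa>_def)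
    also have "\<dots> \<le> real \<kappa> * (real M ^ d / ln (real z) ^ \<kappa>)"
    proof (intro mult_left_mono)
      \<comment> \<open>The close pairs have relative frequency \<open>Q / M\<close>. Since
        \<open>\<kappa> \<le> 5 u\<close>, the power of \<open>ln z\<close> is at most
        \<open>z ^ (5 * u)\<close>, and multiplying by \<open>Q = z ^ u\<close> still stays below
        \<open>M\<close>.\<close>
      have "ln (real z) \<le> real z" using z ln_le_minus_one[of "real z"] by simp
      then have "ln (real z) ^ \<kappa> \<le> real z ^ \<kappa>" using lnz by (intro power_mono) auto
      also have "\<dots> \<le> real z ^ (5 * u)" using z by (intro power_increasing) (auto simp: u_def)
      finally have "real Q * ln (real z) ^ \<kappa> \<le> real z ^ u * real z ^ (5 * u)"
        unfolding Q_def of_nat_power by (intro mult_left_mono) auto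
      also have "\<dots> = real (z ^ (6 * u))" by (simp flip: power_add)
      also have "\<dots> \<le> real M" using z(2) by (simp only: of_nat_le_iff)
      finally have *: "real Q * ln (real z) ^ \<kappa> \<le> real M" .
      have "real Q * real M ^ d / real M = (real Q * ln (real z) ^ \<kappa>) * real M ^ d / (real M * ln (real z) ^ \<kappa>)"
        using lnz by simp
      also have "\<dots> \<le> real M * real M ^ d / (real M * ln (real z) ^ \<kappa>)"
        using * lnz by (intro divide_right_mono mult_right_mono) auto
      finally show "real Q * real M ^ d / real M \<le> real M ^ d / ln (real z) ^ \<kappa>" using M by simp
    qed simp
    finally have 1: "real (card ?P) \<le> real (card ?Sif) + real \<kappa> * (real M ^ d / ln (real z) ^ \<kappa>)"
      by simp
    have 2: "real (card ?Sif) \<le> K / c * (real M ^ d / ln (real z) ^ \<kappa>)"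
    proof -
      let ?L = "\<Sum>S\<in>sieve_support \<kappa> z Q. sieve_density \<kappa> S"
      have "c * ln (real z) ^ \<kappa> \<le> ?L"
        using sum_sieve_density_ge[OF z(1) \<kappa>1] by (simp add: c_def Q_def u_def power_divide)
      then have "real (card ?Sif) * (c * ln (real z) ^ \<kappa>) \<le> real (card ?Sif) * ?L"
        by (intro mult_left_mono) auto
      also have "\<dots> \<le> K * real M ^ d"
        unfolding K_def d_def by (rule card_sifted_le[OF fin disj \<kappa>_def \<kappa>1 Q1 Q6])
      finally show ?thesis using c lnz by (simp add: field_simps)
    qed
    have "real (card ?P) \<le> (K / c + real \<kappa>) * (real M ^ d / ln (real z) ^ \<kappa>)"
      using 1 2 unfolding distrib_right by linarith
    also have "\<dots> \<le> (K / c + real \<kappa>) * (real M ^ d * ((12 * real u) ^ \<kappa> / ln (real M) ^ \<kappa>))"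
    proof (intro mult_left_mono)
      have "ln (real M) ^ \<kappa> \<le> (12 * real u * ln (real z)) ^ \<kappa>" using ln_le lnM by (intro power_mono) auto
      then have "1 / ln (real z) ^ \<kappa> \<le> (12 * real u) ^ \<kappa> / ln (real M) ^ \<kappa>"
        using lnz lnM by (simp add: field_simps)
      then have "real M ^ d * (1 / ln (real z) ^ \<kappa>) \<le> real M ^ d * ((12 * real u) ^ \<kappa> / ln (real M) ^ \<kappa>)"
        by (intro mult_left_mono) auto
      then show "real M ^ d / ln (real z) ^ \<kappa> \<le> real M ^ d * ((12 * real u) ^ \<kappa> / ln (real M) ^ \<kappa>)" by simp
    qed (use c K in auto)
    also have "\<dots> = C1 * real M ^ d / ln (real M) ^ \<kappa>" by (simp add: C1_def)
    also have "\<dots> \<le> (C1 + C2) * real M ^ d / ln (real M) ^ \<kappa>"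
      using C2 lnM by (intro divide_right_mono mult_right_mono) auto
    finally show ?thesis .
  qed
  show ?thesis
    using that[of "C1 + C2"] main C1 C2 unfolding d_def \<kappa>_def by simp
qed

subsection \<open>Interpolation of positive operators\<close>

lemma powr_mult_powr_le:
  fixes a b :: real
  assumes "0 \<le> t" "t \<le> 1" "a \<ge> 0" "b \<ge> 0"
  shows "a powr t * b powr (1 - t) \<le> t * a + (1 - t) * b"
  using Youngs_inequality_0[of t "1 - t" a b] assms
  by (cases "a = 0 \<or> b = 0") auto

lemma Holder_sum:
  fixes a b :: "'a \<Rightarrow> real"
  assumes t: "0 \<le> t" "t \<le> 1" and nn: "\<And>i. i \<in> I \<Longrightarrow> a i \<ge> 0" "\<And>i. i \<in> I \<Longrightarrow> b i \<ge> 0"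
  shows "(\<Sum>i\<in>I. a i powr t * b i powr (1 - t)) \<le> (\<Sum>i\<in>I. a i) powr t * (\<Sum>i\<in>I. b i) powr (1 - t)"
proof (cases "finite I \<and> sum a I > 0 \<and> sum b I > 0")
  \<comment> \<open>Degenerate sums give 0 on the left even at the endpoints \<open>t = 0\<close>
    and \<open>t = 1\<close>, because \<open>0 powr 0 = 0\<close>.\<close>
  case False
  then consider "infinite I" | "finite I" "sum a I = 0" | "finite I" "sum b I = 0"
    using sum_nonneg[of I a] sum_nonneg[of I b] nn by fastforce
  then have "(\<Sum>i\<in>I. a i powr t * b i powr (1 - t)) = 0"
    using nn by cases (auto simp: sum_nonneg_eq_0_iff)
  then show ?thesis by simp
next
  case True
  define X Y where "X = sum a I" and "Y = sum b I"
  have pos: "X > 0" "Y > 0" using True by (auto simp: X_def Y_def)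
  have "(\<Sum>i\<in>I. a i powr t * b i powr (1 - t)) =
      (\<Sum>i\<in>I. X powr t * Y powr (1 - t) * ((a i / X) powr t * (b i / Y) powr (1 - t)))"
    using pos nn by (intro sum.cong) (auto simp: powr_divide)
  also have "\<dots> \<le> (\<Sum>i\<in>I. X powr t * Y powr (1 - t) * (t * (a i / X) + (1 - t) * (b i / Y)))"
    using pos nn t by (intro sum_mono mult_left_mono powr_mult_powr_le) auto
  also have "\<dots> = X powr t * Y powr (1 - t) * (t * (sum a I / X) + (1 - t) * (sum b I / Y))"
    by (simp add: sum.distrib flip: sum_distrib_left sum_divide_distrib)
  also have "\<dots> = X powr t * Y powr (1 - t)"
    using pos unfolding X_def Y_def by simp
  finally show ?thesis by (simp add: X_def Y_def)
qed

text \<open>Riesz--Thorin interpolation for a positive kernel, where Hoelder's inequality gives the pointwise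
  bound \<open>T (f\<^sub>0\<^sup>s f\<^sub>1\<^sup>1\<^sup>-\<^sup>s) \<le> (T f\<^sub>0)\<^sup>s (T f\<^sub>1)\<^sup>1\<^sup>-\<^sup>s\<close>.\<close>

lemma positive_kernel_interpolation:
  fixes k :: "'a \<Rightarrow> 'b \<Rightarrow> real"
  assumes k: "\<And>x y. k x y \<ge> 0" and r: "r0 > 1" "r1 > 1" and t: "0 \<le> t" "t \<le> 1"
    and D: "D0 \<ge> 0" "D1 \<ge> 0"
    and H0: "\<And>f. (\<And>y. f y \<ge> 0) \<Longrightarrow> (\<Sum>x\<in>I. (\<Sum>y\<in>J. k x y * f y) powr r0)
                \<le> D0 * (\<Sum>y\<in>J. f y powr (r0 / (r0 - 1))) powr (r0 - 1)"
    and H1: "\<And>f. (\<And>y. f y \<ge> 0) \<Longrightarrow> (\<Sum>x\<in>I. (\<Sum>y\<in>J. k x y * f y) powr r1)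
                \<le> D1 * (\<Sum>y\<in>J. f y powr (r1 / (r1 - 1))) powr (r1 - 1)"
    and f: "\<And>y. f y \<ge> 0" and r_def: "r = t * r0 + (1 - t) * r1"
  shows "(\<Sum>x\<in>I. (\<Sum>y\<in>J. k x y * f y) powr r)
           \<le> D0 powr t * D1 powr (1 - t) * (\<Sum>y\<in>J. f y powr (r / (r - 1))) powr (r - 1)"
proof -
  have "r - 1 = t * (r0 - 1) + (1 - t) * (r1 - 1)" by (simp add: r_def algebra_simps)
  also have "\<dots> > 0"
  proof (cases "t = 0")
    case False
    then have "t * (r0 - 1) > 0" "(1 - t) * (r1 - 1) \<ge> 0" using t r by auto
    then show ?thesis by linarith
  qed (use r in simp)
  finally have r1: "r > 1" by simp
  define T where "T g x = (\<Sum>y\<in>J. k x y * g y)" for g x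
  define p p0 p1 where "p = r / (r - 1)" and "p0 = r0 / (r0 - 1)" and "p1 = r1 / (r1 - 1)"
  \<comment> \<open>Here \<open>r\<close> itself, not \<open>1 / r\<close>, is the convex
    combination, so \<open>r\<close>-th powers of norms interpolate with weight \<open>t\<close>.
    The weight for the operator is then \<open>s\<close>, since
    \<open>s * r = t * r0\<close>.\<close>
  define s where "s = t * r0 / r"
  have s: "1 - s = (1 - t) * r1 / r" using r1 by (simp add: s_def r_def field_simps)
  have s01: "0 \<le> s" "s \<le> 1"
  proof -
    show "0 \<le> s" using t r r1 by (simp add: s_def)
    have "1 - s \<ge> 0" unfolding s using t r r1 by simp
    then show "s \<le> 1" by simp
  qed
  \<comment> \<open>The powers are balanced so that \<open>f0\<close> to the \<open>p0\<close> and
    \<open>f1\<close> to the \<open>p1\<close> both equal \<open>f\<close> to the \<open>p\<close>;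
    \<open>exps\<close> says that \<open>f\<close> is \<open>f0\<close> to the \<open>s\<close>
    times \<open>f1\<close> to the \<open>1 - s\<close>.\<close>
  define f0 f1 where "f0 y = f y powr (p / p0)" and "f1 y = f y powr (p / p1)" for y
  have T0: "T g x \<ge> 0" if "\<And>y. g y \<ge> 0" for g x
    unfolding T_def using k that by (intro sum_nonneg mult_nonneg_nonneg) auto
  have f01: "f0 y \<ge> 0" "f1 y \<ge> 0" for y by (auto simp: f0_def f1_def)
  have exps: "p / p0 * s + p / p1 * (1 - s) = 1"
  proof -
    have "p / p0 * s = p * (t * (r0 - 1) / r)" using r r1 by (simp add: p0_def s_def)
    moreover have "p / p1 * (1 - s) = p * ((1 - t) * (r1 - 1) / r)" unfolding s using r r1 by (simp add: p1_def)
    ultimately have "p / p0 * s + p / p1 * (1 - s) = p * ((t * (r0 - 1) + (1 - t) * (r1 - 1)) / r)"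
      by (simp add: distrib_left add_divide_distrib)
    also have "t * (r0 - 1) + (1 - t) * (r1 - 1) = r - 1" by (simp add: r_def algebra_simps)
    finally show ?thesis using r1 by (simp add: p_def)
  qed
  have split: "k x y * f y = (k x y * f0 y) powr s * (k x y * f1 y) powr (1 - s)" for x y
  proof (cases "f y = 0 \<or> k x y = 0")
    case False
    then have "f y > 0" "k x y > 0" using f k by (auto simp: order.strict_iff_order)
    then have "(k x y * f0 y) powr s * (k x y * f1 y) powr (1 - s) =
       k x y powr (s + (1 - s)) * f y powr (p / p0 * s + p / p1 * (1 - s))"
      unfolding powr_add by (simp add: powr_mult powr_powr f0_def f1_def)
    also have "\<dots> = k x y * f y" using exps \<open>f y > 0\<close> \<open>k x y > 0\<close> by simp
    finally show ?thesis by simp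
  qed (auto simp: f0_def)
  have "T f x \<le> T f0 x powr s * T f1 x powr (1 - s)" for x
    unfolding T_def split using k f01 s01 by (intro Holder_sum) auto
  then have pw: "T f x powr r \<le> (T f0 x powr r0) powr t * (T f1 x powr r1) powr (1 - t)" for x
  proof -
    assume *: "\<And>x. T f x \<le> T f0 x powr s * T f1 x powr (1 - s)"
    have "T f x powr r \<le> (T f0 x powr s * T f1 x powr (1 - s)) powr r"
      using * r1 T0[of f] f by (intro powr_mono2) auto
    also have "\<dots> = T f0 x powr (s * r) * T f1 x powr ((1 - s) * r)"
      by (simp add: powr_mult powr_powr)
    also have "s * r = r0 * t" using r1 by (simp add: s_def)
    also have "(1 - s) * r = r1 * (1 - t)" unfolding s using r1 by simp
    finally show ?thesis by (simp add: powr_powr)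
  qed
  define S where "S = (\<Sum>y\<in>J. f y powr p)"
  have "(\<Sum>x\<in>I. T f x powr r) \<le> (\<Sum>x\<in>I. (T f0 x powr r0) powr t * (T f1 x powr r1) powr (1 - t))"
    by (intro sum_mono pw)
  also have "\<dots> \<le> (\<Sum>x\<in>I. T f0 x powr r0) powr t * (\<Sum>x\<in>I. T f1 x powr r1) powr (1 - t)"
    using t by (intro Holder_sum) auto
  also have "\<dots> \<le> (D0 * S powr (r0 - 1)) powr t * (D1 * S powr (r1 - 1)) powr (1 - t)"
  proof (intro mult_mono powr_mono2)
    have "p0 \<noteq> 0" "p1 \<noteq> 0" using r by (auto simp: p0_def p1_def)
    then have "(\<Sum>y\<in>J. f0 y powr p0) = S" "(\<Sum>y\<in>J. f1 y powr p1) = S"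
      by (simp_all add: f0_def f1_def S_def powr_powr)
    then show "(\<Sum>x\<in>I. T f0 x powr r0) \<le> D0 * S powr (r0 - 1)" "(\<Sum>x\<in>I. T f1 x powr r1) \<le> D1 * S powr (r1 - 1)"
      using H0[of f0] H1[of f1] f01 by (simp_all add: T_def p0_def p1_def)
  qed (use t in \<open>auto intro!: sum_nonneg\<close>)
  also have "\<dots> = D0 powr t * D1 powr (1 - t) * S powr ((r0 - 1) * t + (r1 - 1) * (1 - t))"
    using D by (simp add: powr_mult powr_powr powr_add)
  also have "(r0 - 1) * t + (r1 - 1) * (1 - t) = r - 1" by (simp add: r_def algebra_simps)
  finally show ?thesis by (simp add: T_def S_def p_def)
qed

text \<open>\<open>B\<close> indexes the \<open>m\<close> copies of \<open>y\<close> from the power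
  on the left. Hoelder's inequality with exponents \<open>m\<close> and \<open>m / (m - 1)\<close>
  separates the kernel from the function: the function part is a tensor power and factors, while the
  \<open>m\<close>-th power of the kernel part brings in \<open>m\<close> copies of
  \<open>x\<close>, indexed by \<open>A\<close>.\<close>

lemma sum_kernel_power_le:
  fixes k :: "'a \<Rightarrow> 'b \<Rightarrow> real" and A B :: "'v set"
  assumes fin: "finite I" "finite J" "finite A" "finite B" and k: "\<And>x y. k x y \<ge> 0"
    and m: "card A = m" "card B = m" "m \<ge> 2" and f: "\<And>y. f y \<ge> 0"
  shows "(\<Sum>x\<in>I. (\<Sum>y\<in>J. k x y * f y) ^ m)
     \<le> (\<Sum>y\<in>PiE B (\<lambda>_. J). \<Sum>x\<in>PiE A (\<lambda>_. I). \<Prod>a\<in>A. \<Prod>b\<in>B. k (x a) (y b)) powr (1 / real m)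
       * (\<Sum>y\<in>J. f y powr (real m / (real m - 1))) powr (real m - 1)"
proof -
  define q where "q = real m / (real m - 1)"
  \<comment> \<open>The weighted number of common neighbours of the tuple \<open>y\<close>.\<close>
  define c where "c y = (\<Sum>x\<in>I. \<Prod>b\<in>B. k x (y b))" for y
  define F where "F y = (\<Prod>b\<in>B. f (y b))" for y
  define S where "S = (\<Sum>y\<in>J. f y powr q)"
  have c0: "c y \<ge> 0" for y unfolding c_def by (intro sum_nonneg prod_nonneg k ballI)
  have F0: "F y \<ge> 0" for y unfolding F_def by (intro prod_nonneg f ballI)
  have S0: "S \<ge> 0" unfolding S_def by (intro sum_nonneg) auto
  have q: "q * (1 - 1 / real m) = 1" using m by (simp add: q_def field_simps)
  have "(\<Sum>x\<in>I. (\<Sum>y\<in>J. k x y * f y) ^ m) = (\<Sum>x\<in>I. \<Prod>b\<in>B. \<Sum>y\<in>J. k x y * f y)"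
    using m by simp
  also have "\<dots> = (\<Sum>x\<in>I. \<Sum>y\<in>PiE B (\<lambda>_. J). \<Prod>b\<in>B. k x (y b) * f (y b))"
    using fin by (subst prod_sum_PiE) auto
  also have "\<dots> = (\<Sum>y\<in>PiE B (\<lambda>_. J). c y * F y)"
    by (subst sum.swap) (simp add: c_def F_def prod.distrib sum_distrib_right)
  also have "\<dots> = (\<Sum>y\<in>PiE B (\<lambda>_. J). (c y ^ m) powr (1 / real m) * (F y powr q) powr (1 - 1 / real m))"
  proof (intro sum.cong refl)
    fix y
    have "(c y ^ m) powr (1 / real m) = c y"
      using c0[of y] m by (cases "c y = 0") (simp_all add: powr_powr zero_power flip: powr_realpow)
    moreover have "(F y powr q) powr (1 - 1 / real m) = F y"
      using F0[of y] q by (simp add: powr_powr)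
    ultimately show "c y * F y = (c y ^ m) powr (1 / real m) * (F y powr q) powr (1 - 1 / real m)" by simp
  qed
  also have "\<dots> \<le> (\<Sum>y\<in>PiE B (\<lambda>_. J). c y ^ m) powr (1 / real m) * (\<Sum>y\<in>PiE B (\<lambda>_. J). F y powr q) powr (1 - 1 / real m)"
    using m c0 by (intro Holder_sum) auto
  also have "(\<Sum>y\<in>PiE B (\<lambda>_. J). F y powr q) = S ^ m"
  proof -
    have "S ^ m = (\<Prod>b\<in>B. \<Sum>y\<in>J. f y powr q)" using m by (simp add: S_def)
    also have "\<dots> = (\<Sum>y\<in>PiE B (\<lambda>_. J). \<Prod>b\<in>B. f (y b) powr q)" using fin by (subst prod_sum_PiE) auto
    finally show ?thesis using f by (simp add: F_def prod_powr_distrib)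
  qed
  also have "(S ^ m) powr (1 - 1 / real m) = S powr (real m - 1)"
  proof (cases "S = 0")
    case False
    have "real m * (1 - 1 / real m) = real m - 1" using m by (simp add: field_simps)
    then show ?thesis using False S0 by (simp add: powr_powr flip: powr_realpow)
  qed (use m in \<open>simp add: zero_power\<close>)
  also have "(\<Sum>y\<in>PiE B (\<lambda>_. J). c y ^ m) =
      (\<Sum>y\<in>PiE B (\<lambda>_. J). \<Sum>x\<in>PiE A (\<lambda>_. I). \<Prod>a\<in>A. \<Prod>b\<in>B. k (x a) (y b))"
  proof (intro sum.cong refl)
    fix y
    have "c y ^ m = (\<Prod>a\<in>A. \<Sum>x\<in>I. \<Prod>b\<in>B. k x (y b))" using m by (simp add: c_def)
    also have "\<dots> = (\<Sum>x\<in>PiE A (\<lambda>_. I). \<Prod>a\<in>A. \<Prod>b\<in>B. k (x a) (y b))"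
      using fin by (subst prod_sum_PiE) auto
    finally show "c y ^ m = (\<Sum>x\<in>PiE A (\<lambda>_. I). \<Prod>a\<in>A. \<Prod>b\<in>B. k (x a) (y b))" .
  qed
  finally show ?thesis by (simp add: S_def q_def)
qed

subsection \<open>Prime averages\<close>

lemma prod_of_bool_eq:
  assumes "finite A" "finite B"
  shows "(\<Prod>a\<in>A. \<Prod>b\<in>B. of_bool (P a b) :: real) = of_bool (\<forall>a\<in>A. \<forall>b\<in>B. P a b)"
proof (cases "\<forall>a\<in>A. \<forall>b\<in>B. P a b")
  case False
  then obtain a b where ab: "a \<in> A" "b \<in> B" "\<not> P a b" by blast
  then have "(\<Prod>b\<in>B. of_bool (P a b) :: real) = 0" using assms by (intro prod_zero) auto
  then have "(\<Prod>a\<in>A. \<Prod>b\<in>B. of_bool (P a b) :: real) = 0" using assms ab by (intro prod_zero) auto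
  then show ?thesis using False by simp
qed simp

text \<open>Translation by \<open>s\<close> preserves differences, and as \<open>A\<close> and
  \<open>B\<close> are disjoint the tuples \<open>x\<close> and \<open>y\<close> merge injectively
  into one point of the cube.\<close>

lemma sum_prime_kernel_tuples_le:
  fixes s :: int and M :: nat and A B :: "'v set"
  assumes fin: "finite A" "finite B" and disj: "A \<inter> B = {}"
  shows "(\<Sum>y\<in>PiE B (\<lambda>_. {s..<s + int M}). \<Sum>x\<in>PiE A (\<lambda>_. {s..<s + int M}).
            \<Prod>a\<in>A. \<Prod>b\<in>B. of_bool (prime (nat (x a - y b))) :: real)
         \<le> real (card {w\<in>cube (A \<union> B) M. \<forall>a\<in>A. \<forall>b\<in>B. prime (nat (w a - w b))})"
proof -
  let ?I = "{s..<s + int M}"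
  let ?X = "PiE A (\<lambda>_. ?I)" and ?Y = "PiE B (\<lambda>_. ?I)"
  let ?R = "\<lambda>(y, x). \<forall>a\<in>A. \<forall>b\<in>B. prime (nat (x a - y b))"
  let ?P = "{w\<in>cube (A \<union> B) M. \<forall>a\<in>A. \<forall>b\<in>B. prime (nat (w a - w b))}"
  define g where "g = (\<lambda>(y, x). \<lambda>v\<in>A \<union> B. (if v \<in> A then x v else y v) - s :: int)"
  have "(\<Sum>y\<in>?Y. \<Sum>x\<in>?X. \<Prod>a\<in>A. \<Prod>b\<in>B. of_bool (prime (nat (x a - y b))) :: real) =
      (\<Sum>e\<in>?Y \<times> ?X. of_bool (?R e))"
    using fin by (simp add: prod_of_bool_eq sum.cartesian_product case_prod_beta)
  also have "\<dots> = real (card ((?Y \<times> ?X) \<inter> {e. ?R e}))"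
    using fin by (subst sum_of_bool_eq) (auto intro!: finite_PiE)
  also have "card ((?Y \<times> ?X) \<inter> {e. ?R e}) \<le> card ?P"
  proof (rule card_inj_on_le[where f = g])
    show "inj_on g ((?Y \<times> ?X) \<inter> {e. ?R e})"
    proof (rule inj_onI)
      fix e e' assume e: "e \<in> (?Y \<times> ?X) \<inter> {e. ?R e}" and e': "e' \<in> (?Y \<times> ?X) \<inter> {e. ?R e}" and eq: "g e = g e'"
      obtain y x y' x' where [simp]: "e = (y, x)" "e' = (y', x')" by (cases e, cases e')
      have "x = x'"
      proof (rule PiE_ext[of x A "\<lambda>_. ?I" x'])
        show "x v = x' v" if "v \<in> A" for v using fun_cong[OF eq, of v] that by (simp add: g_def)
      qed (use e e' in auto)
      moreover have "y = y'"
      proof (rule PiE_ext[of y B "\<lambda>_. ?I" y'])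
        show "y v = y' v" if "v \<in> B" for v
          using fun_cong[OF eq, of v] that disj by (auto simp: g_def split: if_splits)
      qed (use e e' in auto)
      ultimately show "e = e'" by simp
    qed
    show "g ` ((?Y \<times> ?X) \<inter> {e. ?R e}) \<subseteq> ?P"
    proof
      fix w assume "w \<in> g ` ((?Y \<times> ?X) \<inter> {e. ?R e})"
      then obtain y x where yx: "y \<in> ?Y" "x \<in> ?X" "?R (y, x)" and w: "w = g (y, x)" by auto
      have "w \<in> cube (A \<union> B) M"
      proof -
        have "w v \<in> {0..<int M}" if "v \<in> A \<union> B" for v
          using PiE_mem[OF yx(1), of v] PiE_mem[OF yx(2), of v] that by (auto simp: w g_def)
        then show ?thesis unfolding cube_def w by (intro PiE_I) (auto simp: g_def)
      qed
      moreover have "w a - w b = x a - y b" if "a \<in> A" "b \<in> B" for a b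
        using that disj by (auto simp: w g_def)
      ultimately show "w \<in> ?P" using yx(3) by simp
    qed
    show "finite ?P" using finite_cube[of "A \<union> B" M] fin by auto
  qed
  finally show ?thesis by simp
qed

text \<open>A majorant with constant weight and no cutoff \<open>q \<le> N\<close>, as it is only
  used on intervals of length \<open>2 * N\<close>. The argument \<open>2 * N\<close> is that
  length, and it keeps the logarithm positive for \<open>N = 1\<close>. Negative differences become
  0 under \<open>nat\<close> and drop out.\<close>

definition prime_kernel :: "nat \<Rightarrow> int \<Rightarrow> int \<Rightarrow> real" where
  "prime_kernel N x y = ln (2 * real N) / real N * of_bool (prime (nat (x - y)))"

lemma prime_kernel_nonneg: "N \<ge> 1 \<Longrightarrow> prime_kernel N x y \<ge> 0"
  by (simp add: prime_kernel_def)

lemma prime_kernel_local_bound_nat: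
  fixes m :: nat
  assumes m: "m \<ge> 2"
  obtains C where "C > 0"
    "\<And>N s f. N \<ge> 1 \<Longrightarrow> (\<And>y. f y \<ge> 0) \<Longrightarrow>
       (\<Sum>x\<in>{s..<s + 2 * int N}. (\<Sum>y\<in>{s..<s + 2 * int N}. prime_kernel N x y * f y) powr real m)
         \<le> C * real N powr (2 - real m)
            * (\<Sum>y\<in>{s..<s + 2 * int N}. f y powr (real m / (real m - 1))) powr (real m - 1)"
proof -
  let ?A = "{..<m}" and ?B = "{m..<2 * m}"
  have AB: "finite ?A" "finite ?B" "?A \<inter> ?B = {}" "?A \<noteq> {}" "?B \<noteq> {}"
    using m by (auto simp: disjoint_iff lessThan_empty_iff)
  obtain C where C: "C > 0" "\<And>M. M \<ge> 2 \<Longrightarrow>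
      real (card {w\<in>cube (?A \<union> ?B) M. \<forall>a\<in>?A. \<forall>b\<in>?B. prime (nat (w a - w b))})
        \<le> C * real M ^ card (?A \<union> ?B) / ln (real M) ^ (card ?A * card ?B)"
    using card_prime_differences_le[OF AB] by blast
  have card: "card (?A \<union> ?B) = 2 * m" by (subst card_Un_disjoint) (auto simp: disjoint_iff)
  have bound: "(\<Sum>x\<in>{s..<s + 2 * int N}. (\<Sum>y\<in>{s..<s + 2 * int N}. prime_kernel N x y * f y) powr real m)
         \<le> 4 * C powr (1 / real m) * real N powr (2 - real m)
            * (\<Sum>y\<in>{s..<s + 2 * int N}. f y powr (real m / (real m - 1))) powr (real m - 1)"
    if N: "N \<ge> 1" and f: "\<And>y. f y \<ge> 0" for N s and f :: "int \<Rightarrow> real"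
  proof -
    define M where "M = 2 * N"
    have M: "M \<ge> 2" "real M = 2 * real N" using N by (auto simp: M_def)
    let ?I = "{s..<s + int M}"
    have I: "{s..<s + 2 * int N} = ?I" by (simp add: M_def)
    have lnM: "ln (real M) > 0" using M(1) by simp
    define c where "c = ln (real M) / real N"
    have c: "c > 0" using lnM N by (simp add: c_def)
    define k :: "int \<Rightarrow> int \<Rightarrow> real" where "k x y = of_bool (prime (nat (x - y)))" for x y
    define S where "S = (\<Sum>y\<in>?I. f y powr (real m / (real m - 1))) powr (real m - 1)"
    define X where "X = (\<Sum>y\<in>PiE ?B (\<lambda>_. ?I). \<Sum>x\<in>PiE ?A (\<lambda>_. ?I). \<Prod>a\<in>?A. \<Prod>b\<in>?B. k (x a) (y b))"
    have X0: "X \<ge> 0" unfolding X_def k_def by (intro sum_nonneg prod_nonneg ballI) auto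
    have "X \<le> real (card {w\<in>cube (?A \<union> ?B) M. \<forall>a\<in>?A. \<forall>b\<in>?B. prime (nat (w a - w b))})"
      unfolding X_def k_def by (intro sum_prime_kernel_tuples_le) (auto simp: disjoint_iff)
    also have "\<dots> \<le> C * real M ^ (2 * m) / ln (real M) ^ (m * m)"
      using C(2)[OF M(1)] unfolding card by simp
    also have "\<dots> = C * (real M ^ 2 / ln (real M) ^ m) ^ m"
      by (simp add: power_divide power_mult)
    finally have "X powr (1 / real m) \<le> (C * (real M ^ 2 / ln (real M) ^ m) ^ m) powr (1 / real m)"
      using X0 by (intro powr_mono2) auto
    also have "\<dots> = C powr (1 / real m) * (real M ^ 2 / ln (real M) ^ m)"
    proof -
      have pos: "real M ^ 2 / ln (real M) ^ m > 0" using M lnM by simp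
      have "(b ^ m) powr (1 / real m) = b" if "b > 0" for b :: real
        using m that by (simp add: powr_powr flip: powr_realpow[OF that])
      then show ?thesis using C(1) pos by (simp only: powr_mult)
    qed
    finally have X: "X powr (1 / real m) \<le> C powr (1 / real m) * (real M ^ 2 / ln (real M) ^ m)" .
    have "(\<Sum>x\<in>?I. (\<Sum>y\<in>?I. prime_kernel N x y * f y) powr real m) = (\<Sum>x\<in>?I. c ^ m * (\<Sum>y\<in>?I. k x y * f y) ^ m)"
    proof (intro sum.cong refl)
      fix x
      have eq: "(\<Sum>y\<in>?I. prime_kernel N x y * f y) = c * (\<Sum>y\<in>?I. k x y * f y)"
        unfolding prime_kernel_def c_def k_def M(2) sum_distrib_left by (simp only: mult.assoc)
      have "(\<Sum>y\<in>?I. k x y * f y) \<ge> 0" unfolding k_def using f by (intro sum_nonneg mult_nonneg_nonneg) auto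
      then have "c * (\<Sum>y\<in>?I. k x y * f y) \<ge> 0" using c by simp
      then show "(\<Sum>y\<in>?I. prime_kernel N x y * f y) powr real m = c ^ m * (\<Sum>y\<in>?I. k x y * f y) ^ m"
        unfolding eq using m by (subst powr_realpow') (auto simp: power_mult_distrib)
    qed
    also have "\<dots> = c ^ m * (\<Sum>x\<in>?I. (\<Sum>y\<in>?I. k x y * f y) ^ m)" by (simp add: sum_distrib_left)
    also have "\<dots> \<le> c ^ m * (X powr (1 / real m) * S)"
      unfolding X_def S_def using c m f
      by (intro mult_left_mono sum_kernel_power_le) (auto simp: k_def)
    also have "\<dots> \<le> c ^ m * (C powr (1 / real m) * (real M ^ 2 / ln (real M) ^ m) * S)"
      using c X by (intro mult_left_mono mult_right_mono) (auto simp: S_def)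
    \<comment> \<open>The logarithms cancel: \<open>c ^ m\<close> carries \<open>ln M\<close> to the
      \<open>m\<close>, and the \<open>m\<close>-th root of the configuration count carries its
      inverse. The 4 is \<open>(M / N)^2\<close>.\<close>
    also have "\<dots> = 4 * C powr (1 / real m) * (real N ^ 2 / real N ^ m) * S"
      using lnM by (simp add: c_def M(2) power_divide power_mult_distrib)
    also have "real N ^ 2 / real N ^ m = real N powr (2 - real m)"
      using N by (simp add: powr_diff powr_realpow)
    finally show ?thesis unfolding I S_def .
  qed
  show ?thesis
    by (rule that[of "4 * C powr (1 / real m)"]) (use C(1) bound in auto)
qed

lemma prime_kernel_local_bound:
  fixes r :: real
  assumes r: "r \<ge> 2"
  obtains C where "C > 0"
    "\<And>N s f. N \<ge> 1 \<Longrightarrow> (\<And>y. f y \<ge> 0) \<Longrightarrow>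
       (\<Sum>x\<in>{s..<s + 2 * int N}. (\<Sum>y\<in>{s..<s + 2 * int N}. prime_kernel N x y * f y) powr r)
         \<le> C * real N powr (2 - r) * (\<Sum>y\<in>{s..<s + 2 * int N}. f y powr (r / (r - 1))) powr (r - 1)"
proof -
  obtain m :: nat where m: "real m > r" using reals_Archimedean2 by blast
  have m2: "m \<ge> 2" using m r by linarith
  obtain C0 where C0: "C0 > 0"
    "\<And>N s f. N \<ge> 1 \<Longrightarrow> (\<And>y. f y \<ge> 0) \<Longrightarrow>
       (\<Sum>x\<in>{s..<s + 2 * int N}. (\<Sum>y\<in>{s..<s + 2 * int N}. prime_kernel N x y * f y) powr real m)
         \<le> C0 * real N powr (2 - real m)
            * (\<Sum>y\<in>{s..<s + 2 * int N}. f y powr (real m / (real m - 1))) powr (real m - 1)"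
    using prime_kernel_local_bound_nat[OF m2] by blast
  obtain C1 where C1: "C1 > 0"
    "\<And>N s f. N \<ge> 1 \<Longrightarrow> (\<And>y. f y \<ge> 0) \<Longrightarrow>
       (\<Sum>x\<in>{s..<s + 2 * int N}. (\<Sum>y\<in>{s..<s + 2 * int N}. prime_kernel N x y * f y) powr real 2)
         \<le> C1 * real N powr (2 - real 2)
            * (\<Sum>y\<in>{s..<s + 2 * int N}. f y powr (real 2 / (real 2 - 1))) powr (real 2 - 1)"
    using prime_kernel_local_bound_nat[OF order.refl] by blast
  \<comment> \<open>At exponent 2 the power of \<open>N\<close> is 0, and at \<open>m\<close> it is
    \<open>2 - m\<close>; with this \<open>t\<close> it becomes
    \<open>t * (2 - m) = 2 - r\<close>.\<close>
  define t where "t = (r - 2) / (real m - 2)"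
  have t: "0 \<le> t" "t \<le> 1" using m r by (auto simp: t_def)
  have tm: "t * (real m - 2) = r - 2" using m r by (simp add: t_def)
  have req: "r = t * real m + (1 - t) * real 2" using tm by (simp add: algebra_simps)
  have "(\<Sum>x\<in>{s..<s + 2 * int N}. (\<Sum>y\<in>{s..<s + 2 * int N}. prime_kernel N x y * f y) powr r)
         \<le> (C0 powr t * C1 powr (1 - t)) * real N powr (2 - r)
            * (\<Sum>y\<in>{s..<s + 2 * int N}. f y powr (r / (r - 1))) powr (r - 1)"
    if N: "N \<ge> 1" and f: "\<And>y. f y \<ge> 0" for N s and f :: "int \<Rightarrow> real"
  proof -
    let ?D0 = "C0 * real N powr (2 - real m)" and ?D1 = "C1 * real N powr (2 - real 2)"
    have "(\<Sum>x\<in>{s..<s + 2 * int N}. (\<Sum>y\<in>{s..<s + 2 * int N}. prime_kernel N x y * f y) powr r)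
         \<le> ?D0 powr t * ?D1 powr (1 - t) * (\<Sum>y\<in>{s..<s + 2 * int N}. f y powr (r / (r - 1))) powr (r - 1)"
      by (rule positive_kernel_interpolation[where ?r0.0 = "real m" and ?r1.0 = "real 2", OF _ _ _ t _ _ C0(2) C1(2) f req])
        (use N m2 C0(1) C1(1) prime_kernel_nonneg in auto)
    also have "?D0 powr t * ?D1 powr (1 - t) = (C0 powr t * C1 powr (1 - t)) * real N powr ((2 - real m) * t)"
      using C0(1) C1(1) N by (simp add: powr_mult powr_powr)
    also have "(2 - real m) * t = 2 - r" using tm by (simp add: algebra_simps)
    finally show ?thesis .
  qed
  then show ?thesis using that[of "C0 powr t * C1 powr (1 - t)"] C0(1) C1(1) by simp
qed

section \<open>From intervals to all integers\<close>

text \<open>It suffices to bound \<open>e - 1\<close> of the \<open>e\<close> factors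
  \<open>a i\<close> by the whole sum. With \<open>e = r - 1 = p' / p \<ge> 1\<close> this is where
  \<open>p' \<ge> p\<close> enters.\<close>

lemma sum_powr_le_powr_sum:
  fixes a :: "'a \<Rightarrow> real"
  assumes "finite I" "e \<ge> 1" "\<And>i. i \<in> I \<Longrightarrow> a i \<ge> 0"
  shows "(\<Sum>i\<in>I. a i powr e) \<le> (\<Sum>i\<in>I. a i) powr e"
proof -
  let ?S = "\<Sum>i\<in>I. a i"
  have S: "?S \<ge> 0" using assms by (intro sum_nonneg)
  have pw: "x powr e = x * x powr (e - 1)" if "x \<ge> 0" for x :: real
    using that by (cases "x = 0") (simp_all add: powr_diff)
  have "(\<Sum>i\<in>I. a i powr e) \<le> (\<Sum>i\<in>I. a i * ?S powr (e - 1))"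
    using assms by (intro sum_mono) (auto simp: pw intro!: mult_left_mono powr_mono2 member_le_sum)
  also have "\<dots> = ?S powr e" using S by (simp add: pw flip: sum_distrib_right)
  finally show ?thesis .
qed

lemma div_block_bounds:
  assumes "N \<ge> 1"
  shows "x div int N * int N \<le> x" "x < x div int N * int N + int N"
  using div_mult_mod_eq[of x "int N"] pos_mod_bound[of "int N" x] pos_mod_sign[of "int N" x] assms
  by linarith+

text \<open>For \<open>x\<close> in the block from \<open>j N\<close> up to
  \<open>(j + 1) N\<close>, every \<open>x - q\<close> with \<open>1 \<le> q \<le> N\<close> is at
  least \<open>(j - 1) N\<close>. Starting the interval one block early therefore makes it contain
  both \<open>x\<close> and all points that matter for it.\<close>

lemma abs_prime_avg_le:
  fixes x :: int
  assumes N: "N \<ge> 1" and j: "x div int N = j"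
  shows "\<bar>prime_avg N f x\<bar> \<le> (\<Sum>y\<in>{(j - 1) * int N..<(j - 1) * int N + 2 * int N}. prime_kernel N x y * \<bar>f y\<bar>)"
proof -
  let ?Q = "{q. prime q \<and> q \<le> N}" and ?J = "{(j - 1) * int N..<(j - 1) * int N + 2 * int N}"
  have finQ: "finite ?Q" by (rule finite_subset[of _ "{..N}"]) auto
  have x: "j * int N \<le> x" "x < j * int N + int N"
    using div_block_bounds[OF N, of x] j by auto
  have "\<bar>prime_avg N f x\<bar> = 1 / real N * \<bar>\<Sum>q\<in>?Q. f (x - int q) * ln (real q)\<bar>"
    by (simp add: prime_avg_def abs_mult)
  also have "\<dots> \<le> 1 / real N * (\<Sum>q\<in>?Q. \<bar>f (x - int q) * ln (real q)\<bar>)"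
    by (intro mult_left_mono sum_abs) auto
  also have "\<dots> = (\<Sum>q\<in>?Q. 1 / real N * \<bar>f (x - int q) * ln (real q)\<bar>)" by (simp add: sum_distrib_left)
  also have "\<dots> \<le> (\<Sum>y\<in>?J. prime_kernel N x y * \<bar>f y\<bar>)"
  proof (rule sum_le_included[where i = "\<lambda>y. nat (x - y)"])
    show "\<forall>q\<in>?Q. \<exists>y\<in>?J. nat (x - y) = q \<and>
        1 / real N * \<bar>f (x - int q) * ln (real q)\<bar> \<le> prime_kernel N x y * \<bar>f y\<bar>"
    proof (intro ballI bexI conjI)
      fix q assume q: "q \<in> ?Q"
      then have q1: "q \<ge> 1" "q \<le> N" by (auto simp: prime_ge_Suc_0_nat)
      then have "ln (real q) \<le> ln (2 * real N)" "ln (real q) \<ge> 0" using N by auto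
      then have "\<bar>f (x - int q)\<bar> * \<bar>ln (real q)\<bar> / real N \<le> \<bar>f (x - int q)\<bar> * ln (2 * real N) / real N"
        by (intro divide_right_mono mult_left_mono) auto
      then show "1 / real N * \<bar>f (x - int q) * ln (real q)\<bar> \<le> prime_kernel N x (x - int q) * \<bar>f (x - int q)\<bar>"
        using q by (simp add: prime_kernel_def abs_mult mult_ac)
      show "x - int q \<in> ?J" using x q1 by (auto simp: algebra_simps)
    qed simp
  qed (use finQ N prime_kernel_nonneg in auto)
  finally show ?thesis .
qed

text \<open>A point \<open>y\<close> lies in the interval with index \<open>j\<close> only for
  \<open>j = y div N\<close> and \<open>j = y div N + 1\<close>, whence the factor 2.\<close>

lemma sum_overlapping_blocks_le:
  fixes g :: "int \<Rightarrow> real"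
  assumes N: "N \<ge> 1" and J: "finite J" and g: "\<And>y. g y \<ge> 0" "g summable_on UNIV"
  shows "(\<Sum>j\<in>J. \<Sum>y\<in>{(j - 1) * int N..<(j - 1) * int N + 2 * int N}. g y) \<le> 2 * infsum g UNIV"
proof -
  let ?I = "\<lambda>j. {(j - 1) * int N..<(j - 1) * int N + 2 * int N}"
  define Y where "Y = (\<Union>j\<in>J. ?I j)"
  have finY: "finite Y" using J by (auto simp: Y_def)
  have "(\<Sum>j\<in>J. \<Sum>y\<in>?I j. g y) = (\<Sum>j\<in>J. \<Sum>y | y \<in> Y \<and> y \<in> ?I j. g y)"
    by (intro sum.cong refl) (auto simp: Y_def)
  also have "\<dots> = (\<Sum>y\<in>Y. \<Sum>j | j \<in> J \<and> y \<in> ?I j. g y)"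
    using J finY by (rule sum.swap_restrict)
  also have "\<dots> \<le> (\<Sum>y\<in>Y. 2 * g y)"
  proof (rule sum_mono)
    fix y
    have "{j \<in> J. y \<in> ?I j} \<subseteq> {y div int N, y div int N + 1}"
    proof
      fix j assume j: "j \<in> {j \<in> J. y \<in> ?I j}"
      let ?q = "y div int N"
      have "(j - 1) * int N < (?q + 1) * int N" "?q * int N < (j + 1) * int N"
        using j div_block_bounds[OF N, of y] by (auto simp: algebra_simps)
      then have "j - 1 < ?q + 1" "?q < j + 1" using N by (simp_all only: mult_less_cancel_right)
      then show "j \<in> {y div int N, y div int N + 1}" by auto
    qed
    then have "card {j \<in> J. y \<in> ?I j} \<le> card {y div int N, y div int N + 1}" by (intro card_mono) auto
    also have "\<dots> \<le> 2" by (simp add: card_insert_if)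
    finally have "real (card {j \<in> J. y \<in> ?I j}) * g y \<le> 2 * g y" using g(1)[of y] by (intro mult_right_mono) auto
    then show "(\<Sum>j | j \<in> J \<and> y \<in> ?I j. g y) \<le> 2 * g y" by simp
  qed
  also have "\<dots> = 2 * sum g Y" by (simp add: sum_distrib_left)
  also have "sum g Y \<le> infsum g UNIV"
    using g finY by (intro finite_sum_le_infsum) auto
  finally show ?thesis by simp
qed

theorem theorem4:
  fixes p :: real
  assumes "1 < p" and "p \<le> 2"
  shows "\<exists>C>0. \<forall>(N::nat) (f::int \<Rightarrow> real). N \<ge> 1 \<longrightarrow> in_lp p f \<longrightarrow>
           lp_norm (conj_exp p) (prime_avg N f)
             \<le> C * real N powr (1 / conj_exp p - 1 / p) * lp_norm p f"
proof -
  define r where "r = conj_exp p"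
  have r: "r \<ge> 2" using assms by (simp add: r_def conj_exp_def field_simps)
  have rp: "r / (r - 1) = p" "(r - 1) / r = 1 / p" "(2 - r) / r = 1 / r - 1 / p"
    using assms by (simp_all add: r_def conj_exp_def field_simps)
  obtain C where C: "C > 0"
    "\<And>N s f. N \<ge> 1 \<Longrightarrow> (\<And>y. f y \<ge> 0) \<Longrightarrow>
       (\<Sum>x\<in>{s..<s + 2 * int N}. (\<Sum>y\<in>{s..<s + 2 * int N}. prime_kernel N x y * f y) powr r)
         \<le> C * real N powr (2 - r) * (\<Sum>y\<in>{s..<s + 2 * int N}. f y powr (r / (r - 1))) powr (r - 1)"
    using prime_kernel_local_bound[OF r] by blast
  have "lp_norm r (prime_avg N f) \<le> (C powr (1 / r) * 2 powr (1 / p)) * real N powr (1 / r - 1 / p) * lp_norm p f"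
    if N: "N \<ge> 1" and f: "in_lp p f" for N and f :: "int \<Rightarrow> real"
  proof -
    define g where "g y = \<bar>f y\<bar> powr p" for y
    define S where "S = infsum g UNIV"
    have g: "g y \<ge> 0" "g summable_on UNIV" for y using f unfolding g_def in_lp_def by auto
    have S0: "S \<ge> 0" unfolding S_def by (intro infsum_nonneg g)
    define K where "K = C * real N powr (2 - r) * (2 * S) powr (r - 1)"
    have fin_bound: "(\<Sum>x\<in>X. \<bar>prime_avg N f x\<bar> powr r) \<le> K" if X: "finite X" for X
    proof -
      define J where "J = (\<lambda>x. x div int N) ` X"
      have finJ: "finite J" using X by (simp add: J_def)
      define I where "I j = {(j - 1) * int N..<(j - 1) * int N + 2 * int N}" for j
      \<comment> \<open>Each \<open>x\<close> is counted in its own block only; the overlap of the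
        enlarged intervals affects just the right-hand side in \<open>f\<close>.\<close>
      have "(\<Sum>x\<in>X. \<bar>prime_avg N f x\<bar> powr r) = (\<Sum>j\<in>J. \<Sum>x | x \<in> X \<and> x div int N = j. \<bar>prime_avg N f x\<bar> powr r)"
        using X finJ by (intro sum.group[symmetric]) (auto simp: J_def)
      also have "\<dots> \<le> (\<Sum>j\<in>J. C * real N powr (2 - r) * (\<Sum>y\<in>I j. g y) powr (r - 1))"
      proof (rule sum_mono)
        fix j
        have "(\<Sum>x | x \<in> X \<and> x div int N = j. \<bar>prime_avg N f x\<bar> powr r)
            \<le> (\<Sum>x | x \<in> X \<and> x div int N = j. (\<Sum>y\<in>I j. prime_kernel N x y * \<bar>f y\<bar>) powr r)"
          unfolding I_def using r abs_prime_avg_le[OF N] by (intro sum_mono powr_mono2) auto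
        also have "\<dots> \<le> (\<Sum>x\<in>I j. (\<Sum>y\<in>I j. prime_kernel N x y * \<bar>f y\<bar>) powr r)"
        proof (rule sum_mono2)
          show "{x. x \<in> X \<and> x div int N = j} \<subseteq> I j"
          proof
            fix x assume "x \<in> {x. x \<in> X \<and> x div int N = j}"
            then have "j * int N \<le> x" "x < j * int N + int N"
              using div_block_bounds[OF N, of x] by auto
            then show "x \<in> I j" by (auto simp: I_def algebra_simps)
          qed
        qed (auto simp: I_def)
        also have "\<dots> \<le> C * real N powr (2 - r) * (\<Sum>y\<in>I j. g y) powr (r - 1)"
          using C(2)[OF N, of "\<lambda>y. \<bar>f y\<bar>" "(j - 1) * int N"] unfolding rp I_def g_def by simp
        finally show "(\<Sum>x | x \<in> X \<and> x div int N = j. \<bar>prime_avg N f x\<bar> powr r)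
            \<le> C * real N powr (2 - r) * (\<Sum>y\<in>I j. g y) powr (r - 1)" .
      qed
      also have "\<dots> = C * real N powr (2 - r) * (\<Sum>j\<in>J. (\<Sum>y\<in>I j. g y) powr (r - 1))"
        by (simp add: sum_distrib_left)
      also have "\<dots> \<le> K"
        unfolding K_def
      proof (intro mult_left_mono)
        have "(\<Sum>j\<in>J. (\<Sum>y\<in>I j. g y) powr (r - 1)) \<le> (\<Sum>j\<in>J. \<Sum>y\<in>I j. g y) powr (r - 1)"
          using finJ r g by (intro sum_powr_le_powr_sum sum_nonneg) auto
        also have "\<dots> \<le> (2 * S) powr (r - 1)"
          using sum_overlapping_blocks_le[OF N finJ g] r g unfolding I_def S_def
          by (intro powr_mono2 sum_nonneg) auto
        finally show "(\<Sum>j\<in>J. (\<Sum>y\<in>I j. g y) powr (r - 1)) \<le> (2 * S) powr (r - 1)" .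
      qed (use C(1) in auto)
      finally show ?thesis .
    qed
    have K0: "K \<ge> 0" using C(1) by (simp add: K_def)
    have "(\<Sum>\<^sub>\<infinity>x\<in>UNIV. \<bar>prime_avg N f x\<bar> powr r) \<le> K"
    \<comment> \<open>\<open>infsum\<close> is 0 on a family that is not summable, which
      \<open>K \<ge> 0\<close> covers. The uniform bound \<open>fin_bound\<close> on finite sums of
      nonnegative terms shows that this default hides no divergence.\<close>
    proof (cases "(\<lambda>x. \<bar>prime_avg N f x\<bar> powr r) summable_on UNIV")
      case True
      then show ?thesis using fin_bound by (rule infsum_le_finite_sums)
    qed (simp add: infsum_not_exists K0)
    then have "lp_norm r (prime_avg N f) \<le> K powr (1 / r)"
      unfolding lp_norm_def using r by (intro powr_mono2 infsum_nonneg) auto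
    also have "\<dots> = C powr (1 / r) * real N powr ((2 - r) / r) * (2 * S) powr ((r - 1) / r)"
      using C(1) S0 by (simp add: K_def powr_mult powr_powr)
    also have "\<dots> = (C powr (1 / r) * 2 powr (1 / p)) * real N powr (1 / r - 1 / p) * S powr (1 / p)"
      unfolding rp using S0 by (simp add: powr_mult)
    also have "S powr (1 / p) = lp_norm p f" by (simp add: S_def g_def[abs_def] lp_norm_def)
    finally show ?thesis .
  qed
  moreover have "C powr (1 / r) * 2 powr (1 / p) > 0" using C(1) by simp
  ultimately show ?thesis unfolding r_def by blast
qed

end
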